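(* Suppose that $\alpha\in(0,1]$, that $\psi$ is $S$-regular with $S\in\mathbb{N}$, and that $f\in\mathcal{F}^\beta$ for some $0<\beta<S$. Then, for a constant $C(\psi,\alpha,\beta)$ depending only on $\psi,\alpha,\beta$ and all wavelets $\psi_{j,k}$ ($j=0,1,\dots$, $k\in I_j$) of the basis of $L^2([0,1])$, $$|\langle f^\alpha,\psi_{j,k}\rangle|\le C(\psi,\alpha,\beta)\,\|f\|_{\mathcal{F}^\beta}^\alpha\,2^{-\frac j2(2\alpha\beta+1)} .$$ Moreover, for $x_0\in[0,1]$ with $f(x_0)>0$, let $j(x_0)$ be the smallest integer satisfying $$2^{j(x_0)}\ge |\operatorname{supp}(\psi)|\,a^{-1}\left(\frac{\|f\|_{\mathcal{F}^\beta}}{f(x_0)}\right)^{1/\beta},$$ where $a=a(\beta)>0$ is a fixed constant satisfying $(e^a-1)+a^\beta/(\lfloor\beta\rfloor!)\le 1/2$. Then for any wavelet $\psi_{j,k}$ with $j\ge j(x_0)$ and $x_0\in\operatorname{supp}(\psi_{j,k})$, $$|\langle f^\alpha,\psi_{j,k}\rangle|\le C(\psi,\alpha,\beta)\,\frac{\|f\|_{\mathcal{F}^\beta}}{f(x_0)^{1-\alpha}}\,2^{-\frac j2(2\beta+1)} .$$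
   Context: For $\beta>0$, $\lfloor\beta\rfloor$ denotes the largest integer strictly smaller than $\beta$ (so $\lfloor 1\rfloor=0$). For functions on $[0,1]$ let $$|f|_{C^\beta}=\sup_{x\ne y,\;x,y\in[0,1]}\frac{|f^{(\lfloor\beta\rfloor)}(x)-f^{(\lfloor\beta\rfloor)}(y)|}{|x-y|^{\beta-\lfloor\beta\rfloor}},\qquad \|f\|_{C^\beta}=\|f\|_\infty+\|f^{(\lfloor\beta\rfloor)}\|_\infty+|f|_{C^\beta},$$ and $C^\beta=C^\beta([0,1])=\{f:[0,1]\to\mathbb{R}: f^{(\lfloor\beta\rfloor)}\text{ exists},\ \|f\|_{C^\beta}<\infty\}$ (derivatives at endpoints are one-sided). For $f\in C^\beta$, $f\ge0$, define $|f|_{\mathcal{F}^\beta}$ as the infimum over all real $\kappa\ge0$ such that $$|f^{(j)}(x)|^\beta\le \kappa^j|f(x)|^{\beta-j}\quad\text{for all }x\in[0,1]\text{ and all integers }1\le j<\beta,$$ with $|f|_{\mathcal{F}^\beta}=\infty$ if no such $\kappa$ exists, and $|f|_{\mathcal{F}^\beta}=0$ for $\beta\le1$. Set $\|f\|_{\mathcal{F}^\beta}=\|f\|_{C^\beta}+|f|_{\mathcal{F}^\beta}$ and $\mathcal{F}^\beta=\{f\in C^\beta: f\ge0,\ \|f\|_{\mathcal{F}^\beta}<\infty\}$. Wavelets. Let $\phi,\psi$ be a bounded, compactly supported, $S$-regular scaling function and wavelet, $S\in\mathbb{N}$; in particular $\int x^i\psi(x)\,dx=0$ for $i=0,\dots,S-1$.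 Let $\{\phi_k:k\in\mathbb{Z}\}\cup\{\psi_{j,k}:j=0,1,\dots,\ k\in\mathbb{Z}\}$ with $\psi_{j,k}(x)=2^{j/2}\psi(2^jx-k)$ be the corresponding compactly supported orthonormal wavelet basis of $L^2(\mathbb{R})$. From it one constructs an $S$-regular orthonormal wavelet basis $\{\phi_k:k\in I_{-1}\}\cup\{\psi_{j,k}:j=0,1,\dots,\ k\in I_j\}$ of $L^2([0,1])$, with index sets $I_j$ of cardinality at most a constant multiple of $2^j$, by selecting the basis functions whose support intersects $[0,1]$ and correcting those near the boundary by the Cohen–Daubechies–Vial construction. All wavelets $\psi_{j,k}$, $k\in I_j$, of this basis (including the boundary-corrected ones, which are dilations by $2^j$, normalized by $2^{j/2}$, of finitely many fixed functions attached to each endpoint) satisfy: $\|\psi_{j,k}\|_\infty\le C(\psi)2^{j/2}$; $\operatorname{supp}(\psi_{j,k})$ is contained in a subinterval of $[0,1]$ of length at most $2^{-j}|\operatorname{supp}(\psi)|$; and $\int_0^1x^i\psi_{j,k}(x)\,dx=0$ for $i=0,\dots,S-1$. Here $|\operatorname{supp}(\psi)|$ is the length of the support of $\psi$, and $\langle g,h\rangle=\int_0^1g(x)h(x)\,dx$. *)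

theory Defs
  imports "HOL-Analysis.Analysis"
begin

text \<open>
  Functions on \<open>[0,1]\<close> are represented by functions \<open>real \<Rightarrow> real\<close> of which only the values on
  \<open>{0..1}\<close> are ever used. Norms that may be infinite take values in \<^typ>\<open>ennreal\<close>.
\<close>

text \<open>The largest integer strictly smaller than \<open>\<beta>\<close>; differs from the usual floor at integers.\<close>

definition sfloor :: "real \<Rightarrow> nat" where
  "sfloor \<beta> = nat (\<lceil>\<beta>\<rceil> - 1)"

lemma le_sfloor_iff: "0 < \<beta> \<Longrightarrow> n \<le> sfloor \<beta> \<longleftrightarrow> real n < \<beta>"
  unfolding sfloor_def by linarith

text \<open>The derivative within \<open>[0,1]\<close>, hence one-sided at \<open>0\<close> and \<open>1\<close>; its value is only meaningful
  where the derivative exists.\<close>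

definition deriv01 :: "(real \<Rightarrow> real) \<Rightarrow> real \<Rightarrow> real" where
  "deriv01 f x = vector_derivative f (at x within {0..1})"

abbreviation nderiv01 :: "nat \<Rightarrow> (real \<Rightarrow> real) \<Rightarrow> real \<Rightarrow> real" where
  "nderiv01 n f \<equiv> (deriv01 ^^ n) f"

lemma deriv01_eqI:
  assumes "(f has_real_derivative D) (at x within {0..1})" "x \<in> {0..1}"
  shows "deriv01 f x = D"
  unfolding deriv01_def using assms
  by (auto intro!: vector_derivative_within_closed_interval
      simp: has_real_derivative_iff_has_vector_derivative)

definition n_times_differentiable01 :: "nat \<Rightarrow> (real \<Rightarrow> real) \<Rightarrow> bool" where
  "n_times_differentiable01 n f \<longleftrightarrow> (\<forall>i<n. nderiv01 i f differentiable_on {0..1})"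

definition sup_norm01 :: "(real \<Rightarrow> real) \<Rightarrow> ennreal" where
  "sup_norm01 g = (SUP x\<in>{0..1}. ennreal \<bar>g x\<bar>)"

definition C_seminorm :: "real \<Rightarrow> (real \<Rightarrow> real) \<Rightarrow> ennreal" where
  "C_seminorm \<beta> f =
     (SUP (x, y) \<in> {(x, y). x \<in> {0..1} \<and> y \<in> {0..1} \<and> x \<noteq> y}.
        ennreal (\<bar>nderiv01 (sfloor \<beta>) f x - nderiv01 (sfloor \<beta>) f y\<bar>
                   / \<bar>x - y\<bar> powr (\<beta> - real (sfloor \<beta>))))"

definition C_norm :: "real \<Rightarrow> (real \<Rightarrow> real) \<Rightarrow> ennreal" where
  "C_norm \<beta> f = sup_norm01 f + sup_norm01 (nderiv01 (sfloor \<beta>) f) + C_seminorm \<beta> f"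

definition C_space :: "real \<Rightarrow> (real \<Rightarrow> real) set" where
  "C_space \<beta> = {f. n_times_differentiable01 (sfloor \<beta>) f \<and> C_norm \<beta> f < \<infinity>}"

text \<open>The infimum of the empty set is \<open>\<infinity>\<close>. For \<open>\<beta> \<le> 1\<close> there is no \<open>j\<close> to consider, so every
  \<open>\<kappa> \<ge> 0\<close> is admissible and the value is \<open>0\<close>.\<close>

definition F_seminorm :: "real \<Rightarrow> (real \<Rightarrow> real) \<Rightarrow> ennreal" where
  "F_seminorm \<beta> f =
     (INF \<kappa> \<in> {\<kappa>::real. 0 \<le> \<kappa> \<and>
        (\<forall>x\<in>{0..1}. \<forall>j::nat. 1 \<le> j \<and> real j < \<beta> \<longrightarrow>
           \<bar>nderiv01 j f x\<bar> powr \<beta> \<le> \<kappa> ^ j * \<bar>f x\<bar> powr (\<beta> - real j))}. ennreal \<kappa>)"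

lemma F_seminorm_le_1: "\<beta> \<le> 1 \<Longrightarrow> F_seminorm \<beta> f = 0"
proof -
  assume "\<beta> \<le> 1"
  then have "F_seminorm \<beta> f \<le> ennreal 0"
    unfolding F_seminorm_def by (intro INF_lower) auto
  then show ?thesis by simp
qed

definition F_norm :: "real \<Rightarrow> (real \<Rightarrow> real) \<Rightarrow> ennreal" where
  "F_norm \<beta> f = C_norm \<beta> f + F_seminorm \<beta> f"

definition F_space :: "real \<Rightarrow> (real \<Rightarrow> real) set" where
  "F_space \<beta> = {f \<in> C_space \<beta>. (\<forall>x\<in>{0..1}. 0 \<le> f x) \<and> F_norm \<beta> f < \<infinity>}"

definition square_integrable_on :: "(real \<Rightarrow> real) \<Rightarrow> real set \<Rightarrow> bool" where
  "square_integrable_on g A \<longleftrightarrow>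
     g \<in> borel_measurable (lebesgue_on A) \<and> integrable (lebesgue_on A) (\<lambda>x. (g x)\<^sup>2)"

definition inner_L2 :: "real set \<Rightarrow> (real \<Rightarrow> real) \<Rightarrow> (real \<Rightarrow> real) \<Rightarrow> real" where
  "inner_L2 A g h = (LINT x|lebesgue_on A. g x * h x)"

text \<open>The last conjunct says that the linear span is dense in \<open>L\<^sup>2(A)\<close>.\<close>

definition orthonormal_basis_L2 :: "real set \<Rightarrow> 'i set \<Rightarrow> ('i \<Rightarrow> real \<Rightarrow> real) \<Rightarrow> bool" where
  "orthonormal_basis_L2 A J e \<longleftrightarrow>
     (\<forall>i\<in>J. square_integrable_on (e i) A) \<and>
     (\<forall>i\<in>J. \<forall>i'\<in>J. inner_L2 A (e i) (e i') = (if i = i' then 1 else 0)) \<and>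
     (\<forall>g. square_integrable_on g A \<longrightarrow>
        (\<forall>\<epsilon>>0. \<exists>F c. finite F \<and> F \<subseteq> J \<and>
           (LINT x|lebesgue_on A. (g x - (\<Sum>i\<in>F. c i * e i x))\<^sup>2) < \<epsilon>))"

definition supp_on :: "real set \<Rightarrow> (real \<Rightarrow> real) \<Rightarrow> real set" where
  "supp_on A g = closure {x \<in> A. g x \<noteq> 0}"

abbreviation supp :: "(real \<Rightarrow> real) \<Rightarrow> real set" where
  "supp g \<equiv> supp_on UNIV g"

text \<open>The length of the support is the length of the smallest interval containing it.\<close>

definition supp_length :: "(real \<Rightarrow> real) \<Rightarrow> real" where
  "supp_length g = diameter (supp g)"

definition translate :: "(real \<Rightarrow> real) \<Rightarrow> int \<Rightarrow> real \<Rightarrow> real" where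
  "translate \<phi> k x = \<phi> (x - of_int k)"

definition wavelet :: "(real \<Rightarrow> real) \<Rightarrow> nat \<Rightarrow> int \<Rightarrow> real \<Rightarrow> real" where
  "wavelet \<psi> j k x = 2 powr (real j / 2) * \<psi> (2 ^ j * x - of_int k)"

definition projection_kernel :: "(real \<Rightarrow> real) \<Rightarrow> real \<Rightarrow> real \<Rightarrow> real" where
  "projection_kernel \<phi> x y = (\<Sum>\<^sub>\<infinity>k. translate \<phi> k x * translate \<phi> k y)"

text \<open>
  A bounded, compactly supported, \<open>S\<close>-regular scaling function and wavelet. Regularity is meant in
  the sense of Gine and Nickl: \<open>S\<close> vanishing moments of \<open>\<psi>\<close>, and the projection kernel reproduces
  polynomials of degree below \<open>S\<close>. Their additional localisation conditions on the kernels hold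
  automatically for bounded functions of compact support. The two-scale relations need not be
  required, as they follow from the orthonormal basis property.
\<close>

locale regular_wavelet_pair =
  fixes S :: nat and \<phi> \<psi> :: "real \<Rightarrow> real"
  assumes bounded: "bounded (range \<phi>)" "bounded (range \<psi>)"
    and compact_support: "compact (supp \<phi>)" "compact (supp \<psi>)"
    and basis_line:
      "orthonormal_basis_L2 UNIV (UNIV :: (int + nat \<times> int) set)
         (case_sum (translate \<phi>) (\<lambda>(j, k). wavelet \<psi> j k))"
    and vanishing_moments: "\<And>i. i < S \<Longrightarrow> (LINT x|lebesgue. x ^ i * \<psi> x) = 0"
    and kernel_moments:
      "\<And>i. i < S \<Longrightarrow> AE x in lebesgue.
         (LINT y|lebesgue. projection_kernel \<phi> x (x + y) * y ^ i) = (if i = 0 then 1 else 0)"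

text \<open>
  The scaling functions \<open>\<Phi> k\<close>, \<open>k \<in> I0\<close>, and wavelets \<open>\<Psi> j k\<close>, \<open>k \<in> I j\<close>, of an orthonormal basis of
  \<open>L\<^sup>2([0,1])\<close> obtained from \<open>\<phi>\<close> and \<open>\<psi>\<close> by a Cohen--Daubechies--Vial boundary correction. The
  basis functions on the line supported at distance at least \<open>d 2\<^sup>-\<^sup>j\<close> from the boundary are kept
  unchanged; the remaining wavelets are either unchanged or dilations of one of the finitely many
  functions in \<open>L\<close> and \<open>R\<close>, attached to the endpoints \<open>0\<close> and \<open>1\<close> respectively (the index \<open>k\<close> is then
  a mere label). The number \<open>K\<close> is the constant \<open>C(\<psi>)\<close> in the bound on the sup norms.
\<close>

locale interval_wavelet_basis =
  fixes S :: nat and \<phi> \<psi> :: "real \<Rightarrow> real" and K :: real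
    and I0 :: "int set" and \<Phi> :: "int \<Rightarrow> real \<Rightarrow> real"
    and I :: "nat \<Rightarrow> int set" and \<Psi> :: "nat \<Rightarrow> int \<Rightarrow> real \<Rightarrow> real"
  assumes basis_interval:
      "orthonormal_basis_L2 {0..1} (I0 <+> Sigma UNIV I) (case_sum \<Phi> (\<lambda>(j, k). \<Psi> j k))"
    and index_sets: "finite I0" "\<exists>c::nat. \<forall>j. finite (I j) \<and> card (I j) \<le> c * 2 ^ j"
    and boundary_correction:
      "\<exists>d L R. 0 \<le> d \<and> finite L \<and> finite R \<and>
         (\<forall>k. supp (translate \<phi> k) \<subseteq> {d..1 - d} \<longrightarrow>
            k \<in> I0 \<and> (\<forall>x\<in>{0..1}. \<Phi> k x = translate \<phi> k x)) \<and>
         (\<forall>j k. supp (wavelet \<psi> j k) \<subseteq> {d / 2 ^ j..1 - d / 2 ^ j} \<longrightarrow>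
            k \<in> I j \<and> (\<forall>x\<in>{0..1}. \<Psi> j k x = wavelet \<psi> j k x)) \<and>
         (\<forall>j. \<forall>k\<in>I j.
            (\<forall>x\<in>{0..1}. \<Psi> j k x = wavelet \<psi> j k x) \<or>
            (\<exists>g\<in>L. \<forall>x\<in>{0..1}. \<Psi> j k x = 2 powr (real j / 2) * g (2 ^ j * x)) \<or>
            (\<exists>g\<in>R. \<forall>x\<in>{0..1}. \<Psi> j k x = 2 powr (real j / 2) * g (2 ^ j * (x - 1))))"
    and sup_bound:
      "\<And>j k x. k \<in> I j \<Longrightarrow> x \<in> {0..1} \<Longrightarrow> \<bar>\<Psi> j k x\<bar> \<le> K * 2 powr (real j / 2)"
    and support:
      "\<And>j k. k \<in> I j \<Longrightarrow> \<exists>u v. 0 \<le> u \<and> u \<le> v \<and> v \<le> 1 \<and> v - u \<le> supp_length \<psi> / 2 ^ j \<and>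
         supp_on {0..1} (\<Psi> j k) \<subseteq> {u..v}"
    and moments_interval:
      "\<And>j k i. k \<in> I j \<Longrightarrow> i < S \<Longrightarrow> (LINT x|lebesgue_on {0..1}. x ^ i * \<Psi> j k x) = 0"

text \<open>The integer \<open>j(x\<^sub>0)\<close>; it may be negative.\<close>

definition j_threshold :: "(real \<Rightarrow> real) \<Rightarrow> real \<Rightarrow> real \<Rightarrow> (real \<Rightarrow> real) \<Rightarrow> real \<Rightarrow> int" where
  "j_threshold \<psi> \<beta> a f x0 =
     (LEAST m::int. supp_length \<psi> * inverse a * (enn2real (F_norm \<beta> f) / f x0) powr (1 / \<beta>)
        \<le> 2 powr real_of_int m)"

end

theory Submission
  imports Defs "HOL-Computational_Algebra.Polynomial"
begin

text \<open>
  A wavelet with \<open>S\<close> vanishing moments annihilates polynomials of degree below \<open>S\<close>, so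
  \<open>\<langle>f\<^sup>\<alpha>, \<psi>\<^bsub>j,k\<^esub>\<rangle>\<close> is controlled by the distance from \<open>f\<^sup>\<alpha>\<close> to such polynomials on the support, an
  interval of length \<open>h\<close> comparable to \<open>2\<^sup>-\<^sup>j\<close> (lemma \<open>coefficient_le_poly_error\<close>). Write \<open>F\<close> for the
  norm of \<open>f\<close>, \<open>n\<close> for the order of its top derivative, and fix a point \<open>x\<^sub>0\<close> with \<open>f(x\<^sub>0) > 0\<close>.

  The length \<open>\<rho> = (f(x\<^sub>0)/F)\<^bsup>1/\<beta>\<^esup>\<close> is the scale on which \<open>f\<close> is almost constant near \<open>x\<^sub>0\<close>. Put
  \<open>t = (x - x\<^sub>0)/\<rho>\<close>. Taylor's formula reads \<open>f(x) = f(x\<^sub>0) (1 + q(t) + r)\<close> with a polynomial \<open>q\<close> of degree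
  at most \<open>n\<close> without constant term. The flatness part of the norm implies that the coefficient
  of \<open>t\<^sup>i\<close> in \<open>q\<close> is at most \<open>1/i!\<close> in absolute value, and the Hoelder part that \<open>\<bar>r\<bar> \<le> \<bar>t\<bar>\<^sup>\<beta>/n!\<close>. The
  condition on \<open>a\<close> therefore gives \<open>\<bar>q\<bar> + \<bar>r\<bar> \<le> 1/2\<close> for \<open>\<bar>t\<bar> \<le> a\<close>.

  On this range \<open>y \<mapsto> y\<^sup>\<alpha>\<close> is Lipschitz, so dropping \<open>r\<close> from \<open>(1 + q + r)\<^sup>\<alpha>\<close> costs \<open>O(\<bar>t\<bar>\<^sup>\<beta>)\<close>; and
  \<open>(1 + q(t))\<^sup>\<alpha>\<close> is replaced by a polynomial of degree at most \<open>n\<close> in \<open>t\<close> by cutting off first the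
  binomial series in \<open>q\<close> and then the resulting polynomial in \<open>t\<close>, at a cost of \<open>O(\<bar>t\<bar>\<^bsup>n+1\<^esup>)\<close>. All constants
  depend on \<open>n\<close> alone. This yields a polynomial at distance \<open>O(f(x\<^sub>0)\<^sup>\<alpha> \<bar>t\<bar>\<^sup>\<beta>)\<close> from \<open>f\<^sup>\<alpha>\<close> (lemma
  \<open>F_space_powr_poly_approx\<close>) without differentiating \<open>f\<^sup>\<alpha>\<close>. Since
  \<open>f(x\<^sub>0)\<^sup>\<alpha> (h/\<rho>)\<^sup>\<beta> = F f(x\<^sub>0)\<^bsup>\<alpha>-1\<^esup> h\<^sup>\<beta>\<close>, it is the second assertion: \<open>j \<ge> j(x\<^sub>0)\<close> means \<open>h \<le> a \<rho>\<close>.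

  The first assertion follows from a dichotomy (lemma \<open>coefficient_bound_uniform\<close>). Either
  \<open>f \<le> F (h/a)\<^sup>\<beta>\<close> on the whole support, so that \<open>f\<^sup>\<alpha>\<close> itself is of the required size
  \<open>O(F\<^sup>\<alpha> h\<^bsup>\<alpha>\<beta>\<^esup>)\<close>; or some point \<open>x\<^sub>1\<close> of the support violates this, which is the condition \<open>h < a \<rho>\<close> at
  \<open>x\<^sub>1\<close>, and then \<open>F f(x\<^sub>1)\<^bsup>\<alpha>-1\<^esup> h\<^sup>\<beta>\<close> is \<open>O(F\<^sup>\<alpha> h\<^bsup>\<alpha>\<beta>\<^esup>)\<close> because the exponent \<open>\<alpha> - 1\<close> is not positive.
\<close>

section \<open>The coefficient norm and truncation of polynomials\<close>

text \<open>
  The sum of the absolute values of the coefficients is submultiplicative and dominates \<open>p\<close> on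
  \<open>[-1,1]\<close>. It keeps the truncation errors below uniform over all functions \<open>f\<close>.
\<close>

definition coeff_l1 :: "real poly \<Rightarrow> real" where
  "coeff_l1 p = (\<Sum>i\<le>degree p. \<bar>coeff p i\<bar>)"

lemma coeff_l1_0 [simp]: "coeff_l1 0 = 0"
  by (simp add: coeff_l1_def)

lemma coeff_l1_pCons: "coeff_l1 (pCons a p) = \<bar>a\<bar> + coeff_l1 p"
proof (cases "p = 0")
  case False
  then show ?thesis
    unfolding coeff_l1_def by (simp add: sum.atMost_Suc_shift del: sum.atMost_Suc)
qed (simp add: coeff_l1_def)

lemma coeff_l1_nonneg: "0 \<le> coeff_l1 p"
  by (simp add: coeff_l1_def sum_nonneg)

lemma coeff_l1_smult: "coeff_l1 (smult c p) = \<bar>c\<bar> * coeff_l1 p"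
  by (induction p) (auto simp: coeff_l1_pCons algebra_simps abs_mult)

lemma coeff_l1_add: "coeff_l1 (p + q) \<le> coeff_l1 p + coeff_l1 q"
  by (induction p q rule: poly_induct2) (auto simp: coeff_l1_pCons)

lemma coeff_l1_mult: "coeff_l1 (p * q) \<le> coeff_l1 p * coeff_l1 q"
proof (induction p)
  case (pCons a p)
  have "coeff_l1 (pCons a p * q) \<le> coeff_l1 (smult a q) + coeff_l1 (pCons 0 (p * q))"
    by (simp add: coeff_l1_add)
  also have "\<dots> \<le> \<bar>a\<bar> * coeff_l1 q + coeff_l1 p * coeff_l1 q"
    using pCons.IH by (simp add: coeff_l1_smult coeff_l1_pCons)
  finally show ?case by (simp add: coeff_l1_pCons algebra_simps)
qed simp

lemma coeff_l1_power: "coeff_l1 (p ^ i) \<le> coeff_l1 p ^ i"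
proof (induction i)
  case (Suc i)
  have "coeff_l1 (p ^ Suc i) \<le> coeff_l1 p * coeff_l1 (p ^ i)"
    by (simp add: coeff_l1_mult)
  also have "\<dots> \<le> coeff_l1 p * coeff_l1 p ^ i"
    by (intro mult_left_mono Suc.IH coeff_l1_nonneg)
  finally show ?case by simp
qed (simp add: one_pCons coeff_l1_pCons)

lemma coeff_l1_sum: "coeff_l1 (sum g A) \<le> (\<Sum>i\<in>A. coeff_l1 (g i))"
  by (induction A rule: infinite_finite_induct) (auto intro: order_trans[OF coeff_l1_add])

lemma coeff_l1_monom: "coeff_l1 (monom c i) = \<bar>c\<bar>"
  by (induction i) (auto simp: monom_0 monom_Suc coeff_l1_pCons)

lemma abs_poly_le_coeff_l1: "\<bar>t\<bar> \<le> 1 \<Longrightarrow> \<bar>poly p t\<bar> \<le> coeff_l1 p"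
proof (induction p)
  case (pCons a p)
  have "\<bar>t * poly p t\<bar> \<le> 1 * coeff_l1 p"
    unfolding abs_mult using pCons by (intro mult_mono) auto
  then show ?case by (auto simp: coeff_l1_pCons)
qed simp

text \<open>
  Every monomial that is cut off is at most \<open>\<bar>t\<bar>\<^bsup>n+1\<^esup>\<close> in absolute value on \<open>[-1,1]\<close>.
\<close>

lemma poly_truncation:
  "\<exists>q. degree q \<le> n \<and> (\<forall>t. \<bar>t\<bar> \<le> 1 \<longrightarrow> \<bar>poly p t - poly q t\<bar> \<le> coeff_l1 p * \<bar>t\<bar> ^ Suc n)"
proof (induction n arbitrary: p)
  case 0
  obtain a r where p: "p = pCons a r" by (cases p) 
  have "\<bar>poly p t - poly [:a:] t\<bar> \<le> coeff_l1 p * \<bar>t\<bar> ^ Suc 0" if "\<bar>t\<bar> \<le> 1" for t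
  proof -
    have "\<bar>poly r t\<bar> * \<bar>t\<bar> \<le> coeff_l1 p * \<bar>t\<bar>"
      using abs_poly_le_coeff_l1[OF that, of r]
      by (intro mult_right_mono) (auto simp: p coeff_l1_pCons)
    then show ?thesis by (simp add: p abs_mult mult.commute)
  qed
  then show ?case by (intro exI[of _ "[:a:]"]) auto
next
  case (Suc n)
  obtain a r where p: "p = pCons a r" by (cases p)
  obtain q where q: "degree q \<le> n"
    "\<And>t. \<bar>t\<bar> \<le> 1 \<Longrightarrow> \<bar>poly r t - poly q t\<bar> \<le> coeff_l1 r * \<bar>t\<bar> ^ Suc n"
    using Suc.IH[of r] by blast
  have "\<bar>poly p t - poly (pCons a q) t\<bar> \<le> coeff_l1 p * \<bar>t\<bar> ^ Suc (Suc n)" if "\<bar>t\<bar> \<le> 1" for t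
  proof -
    have "\<bar>poly p t - poly (pCons a q) t\<bar> = \<bar>t\<bar> * \<bar>poly r t - poly q t\<bar>"
      by (simp add: p abs_mult flip: right_diff_distrib)
    also have "\<dots> \<le> \<bar>t\<bar> * (coeff_l1 p * \<bar>t\<bar> ^ Suc n)"
      by (intro mult_left_mono order_trans[OF q(2)[OF that]] mult_right_mono)
         (auto simp: p coeff_l1_pCons)
    finally show ?thesis by (simp add: mult_ac)
  qed
  moreover have "degree (pCons a q) \<le> Suc n"
    using q(1) by (simp add: degree_pCons_eq_if)
  ultimately show ?case by blast
qed

section \<open>Powers of a polynomial perturbation of 1\<close>

lemma abs_gbinomial_le_1:
  fixes \<alpha> :: real
  assumes "0 \<le> \<alpha>" "\<alpha> \<le> 1"
  shows "\<bar>\<alpha> gchoose i\<bar> \<le> 1"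
proof (induction i)
  case (Suc i)
  have "(\<alpha> gchoose Suc i) = (\<alpha> gchoose i) * ((\<alpha> - real i) / real (Suc i))"
    using gbinomial_absorb_comp[of \<alpha> i] gbinomial_absorption[of i \<alpha>]
    by (simp add: field_simps)
  moreover have "\<bar>(\<alpha> - real i) / real (Suc i)\<bar> \<le> 1"
    using assms by (simp add: abs_le_iff field_simps)
  ultimately show ?case
    using Suc.IH by (simp only: abs_mult mult_le_one abs_ge_zero)
qed simp

text \<open>
  The binomial coefficients are bounded by \<open>1\<close>, so the tail of the series is dominated by a geometric
  series of ratio at most \<open>1/2\<close>.
\<close>

lemma powr_binomial_remainder:
  fixes \<alpha> y :: real
  assumes "0 \<le> \<alpha>" "\<alpha> \<le> 1" "\<bar>y\<bar> \<le> 1 / 2"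
  shows "\<bar>(1 + y) powr \<alpha> - (\<Sum>i\<le>n. (\<alpha> gchoose i) * y ^ i)\<bar> \<le> 2 * \<bar>y\<bar> ^ Suc n"
proof -
  have "(\<lambda>i. (\<alpha> gchoose i) * y ^ i) sums (1 + y) powr \<alpha>"
    using assms gen_binomial_real[of y \<alpha>] by simp
  then have tail: "(\<lambda>i. (\<alpha> gchoose (i + Suc n)) * y ^ (i + Suc n)) sums
      ((1 + y) powr \<alpha> - (\<Sum>i\<le>n. (\<alpha> gchoose i) * y ^ i))"
    by (subst sums_iff_shift) (simp only: lessThan_Suc_atMost diff_add_cancel)
  have geo: "(\<lambda>i. \<bar>y\<bar> ^ Suc n * \<bar>y\<bar> ^ i) sums (\<bar>y\<bar> ^ Suc n * (1 / (1 - \<bar>y\<bar>)))"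
    using assms by (intro sums_mult geometric_sums) auto
  have "\<bar>(1 + y) powr \<alpha> - (\<Sum>i\<le>n. (\<alpha> gchoose i) * y ^ i)\<bar> \<le> \<bar>y\<bar> ^ Suc n * (1 / (1 - \<bar>y\<bar>))"
  proof -
    have "norm (\<Sum>i. (\<alpha> gchoose (i + Suc n)) * y ^ (i + Suc n)) \<le> (\<Sum>i. \<bar>y\<bar> ^ Suc n * \<bar>y\<bar> ^ i)"
    proof (rule norm_suminf_le)
      show "norm ((\<alpha> gchoose (i + Suc n)) * y ^ (i + Suc n)) \<le> \<bar>y\<bar> ^ Suc n * \<bar>y\<bar> ^ i" for i
        using mult_right_mono[OF abs_gbinomial_le_1[OF assms(1,2), of "i + Suc n"], of "\<bar>y\<bar> ^ (i + Suc n)"]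
        by (simp add: abs_mult power_abs power_add mult_ac)
    qed (use geo sums_summable in blast)
    then show ?thesis
      using tail geo by (simp add: sums_iff)
  qed
  also have "\<dots> \<le> \<bar>y\<bar> ^ Suc n * 2"
    using assms by (intro mult_left_mono) (auto simp: field_simps)
  finally show ?thesis by (simp add: mult.commute)
qed

text \<open>
  The binomial expansion of \<open>(1 + q)\<^sup>\<alpha>\<close> up to order \<open>n\<close> has degree up to \<open>n\<close> times that of \<open>q\<close>, and
  vanishing moments are available only for degrees up to \<open>n\<close>; hence the second truncation, in \<open>t\<close>.
  Both remainders are of order \<open>\<bar>t\<bar>\<^bsup>n+1\<^esup>\<close>, the first because \<open>q(0) = 0\<close> forces \<open>\<bar>q(t)\<bar> \<le> B \<bar>t\<bar>\<close>.
\<close>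

lemma powr_comp_poly_approx:
  fixes \<alpha> B :: real
  assumes "0 \<le> \<alpha>" "\<alpha> \<le> 1" "coeff q 0 = 0" "coeff_l1 q \<le> B"
  shows "\<exists>p. degree p \<le> n \<and> (\<forall>t. \<bar>t\<bar> \<le> 1 \<and> \<bar>poly q t\<bar> \<le> 1 / 2 \<longrightarrow>
           \<bar>(1 + poly q t) powr \<alpha> - poly p t\<bar> \<le> (2 * B ^ Suc n + (\<Sum>i\<le>n. B ^ i)) * \<bar>t\<bar> ^ Suc n)"
proof -
  define P where "P = (\<Sum>i\<le>n. smult (\<alpha> gchoose i) (q ^ i))"
  have B: "0 \<le> B" using assms(4) coeff_l1_nonneg[of q] by linarith
  have P_l1: "coeff_l1 P \<le> (\<Sum>i\<le>n. B ^ i)"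
    unfolding P_def
  proof (intro order_trans[OF coeff_l1_sum] sum_mono)
    fix i
    have "\<bar>\<alpha> gchoose i\<bar> * coeff_l1 (q ^ i) \<le> 1 * B ^ i"
      using abs_gbinomial_le_1[OF assms(1,2)] coeff_l1_power[of q i]
        power_mono[OF assms(4) coeff_l1_nonneg, of i] coeff_l1_nonneg[of "q ^ i"]
      by (intro mult_mono) auto
    then show "coeff_l1 (smult (\<alpha> gchoose i) (q ^ i)) \<le> B ^ i"
      by (simp add: coeff_l1_smult)
  qed
  obtain p where p: "degree p \<le> n"
    "\<And>t. \<bar>t\<bar> \<le> 1 \<Longrightarrow> \<bar>poly P t - poly p t\<bar> \<le> coeff_l1 P * \<bar>t\<bar> ^ Suc n"
    using poly_truncation[of n P] by blast
  have "\<bar>(1 + poly q t) powr \<alpha> - poly p t\<bar> \<le> (2 * B ^ Suc n + (\<Sum>i\<le>n. B ^ i)) * \<bar>t\<bar> ^ Suc n"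
    if t: "\<bar>t\<bar> \<le> 1" "\<bar>poly q t\<bar> \<le> 1 / 2" for t
  proof -
    obtain r where r: "q = pCons 0 r"
      using assms(3) by (cases q) auto
    have "\<bar>poly q t\<bar> \<le> B * \<bar>t\<bar>"
      using abs_poly_le_coeff_l1[OF t(1), of r] assms(4) mult_right_mono[of "\<bar>poly r t\<bar>" B "\<bar>t\<bar>"]
      by (simp add: r coeff_l1_pCons abs_mult mult.commute)
    then have "\<bar>poly q t\<bar> ^ Suc n \<le> B ^ Suc n * \<bar>t\<bar> ^ Suc n"
      unfolding power_mult_distrib[symmetric] by (intro power_mono) auto
    moreover have "\<bar>(1 + poly q t) powr \<alpha> - poly P t\<bar> \<le> 2 * \<bar>poly q t\<bar> ^ Suc n"
      using powr_binomial_remainder[OF assms(1,2) t(2), of n]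
      by (simp add: P_def poly_sum)
    moreover have "\<bar>poly P t - poly p t\<bar> \<le> (\<Sum>i\<le>n. B ^ i) * \<bar>t\<bar> ^ Suc n"
      by (rule order_trans[OF p(2)[OF t(1)]], rule mult_right_mono[OF P_l1]) auto
    ultimately show ?thesis
      unfolding distrib_right by linarith
  qed
  with p(1) show ?thesis by blast
qed

lemma powr_diff_le:
  fixes \<alpha> x y :: real
  assumes "0 \<le> \<alpha>" "\<alpha> \<le> 1" "1 / 2 \<le> x" "1 / 2 \<le> y"
  shows "\<bar>x powr \<alpha> - y powr \<alpha>\<bar> \<le> 2 * \<bar>x - y\<bar>"
proof -
  have "norm (x powr \<alpha> - y powr \<alpha>) \<le> 2 * norm (x - y)"
  proof (rule field_differentiable_bound[of "{1/2..}"])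
    show "((\<lambda>z. z powr \<alpha>) has_field_derivative \<alpha> * z powr (\<alpha> - 1)) (at z within {1/2..})"
      if "z \<in> {1/2..}" for z
      using that by (intro has_field_derivative_at_within[OF has_real_derivative_powr]) auto
    show "norm (\<alpha> * z powr (\<alpha> - 1)) \<le> 2" if "z \<in> {1/2..}" for z
    proof -
      have "z powr (\<alpha> - 1) \<le> (1/2) powr (\<alpha> - 1)"
        using that assms by (intro powr_mono2') auto
      also have "\<dots> \<le> (1/2) powr (-1)"
        using assms by (intro powr_mono') auto
      finally have "z powr (\<alpha> - 1) \<le> 2" by (simp add: powr_minus)
      then have "\<alpha> * z powr (\<alpha> - 1) \<le> 1 * 2"
        using assms by (intro mult_mono) auto
      then show ?thesis using assms by (simp add: abs_mult)
    qed
  qed (use assms in auto)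
  then show ?thesis by simp
qed

section \<open>Taylor's formula with one-sided derivatives\<close>

text \<open>
  The mean value inequality against the primitive of \<open>s\<^sup>n\<close>, after parametrising the segment over
  \<open>[0,1]\<close>; this treats \<open>x < x\<^sub>0\<close> and \<open>x > x\<^sub>0\<close> alike and produces the factor \<open>1/(n+1)\<close> that builds up
  the factorial in the Taylor remainder.
\<close>

lemma abs_diff_le_of_deriv_power_bound:
  fixes D :: "real \<Rightarrow> real"
  assumes "\<And>t. t \<in> closed_segment x0 x \<Longrightarrow> (D has_real_derivative D' t) (at t within S)"
    and "closed_segment x0 x \<subseteq> S"
    and "\<And>t. t \<in> closed_segment x0 x \<Longrightarrow> \<bar>D' t\<bar> \<le> c * \<bar>t - x0\<bar> ^ n"
  shows "\<bar>D x - D x0\<bar> \<le> c * \<bar>x - x0\<bar> ^ Suc n / real (Suc n)"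
proof -
  define \<gamma> where "\<gamma> s = x0 + s * (x - x0)" for s
  define \<Phi> where "\<Phi> s = c * \<bar>x - x0\<bar> ^ Suc n * (s ^ Suc n / real (Suc n))" for s :: real
  have \<gamma>: "\<gamma> s \<in> closed_segment x0 x" if "s \<in> {0..1}" for s
    using that unfolding closed_segment_def \<gamma>_def by (auto intro!: exI[of _ s] simp: algebra_simps)
  have deriv: "((\<lambda>s. D (\<gamma> s)) has_real_derivative D' (\<gamma> s) * (x - x0)) (at s within {0..1})"
    if "s \<in> {0..1}" for s
  proof -
    have "(\<gamma> has_real_derivative (x - x0)) (at s within {0..1})"
      unfolding \<gamma>_def by (auto intro!: derivative_eq_intros)
    moreover have "(D has_real_derivative D' (\<gamma> s)) (at (\<gamma> s) within \<gamma> ` {0..1})"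
      using assms(1)[OF \<gamma>[OF that]] assms(2) \<gamma> by (elim DERIV_subset) auto
    ultimately show ?thesis
      using DERIV_image_chain[of D "D' (\<gamma> s)" \<gamma> s "{0..1}" "x - x0"] by (simp add: o_def)
  qed
  have "norm (D (\<gamma> 1) - D (\<gamma> 0)) \<le> \<Phi> 1 - \<Phi> 0"
  proof (rule differentiable_bound_general[of 0 1])
    show "continuous_on {0..1} (\<lambda>s. D (\<gamma> s))"
      using deriv by (rule DERIV_continuous_on)
    show "continuous_on {0..1} \<Phi>"
      unfolding \<Phi>_def by (intro continuous_intros) auto
    fix s :: real assume s: "0 < s" "s < 1"
    then have at: "at s within {0..1} = at s"
      by (intro at_within_interior) auto
    show "((\<lambda>s. D (\<gamma> s)) has_vector_derivative D' (\<gamma> s) * (x - x0)) (at s)"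
      using deriv[of s] s by (simp add: at has_real_derivative_iff_has_vector_derivative)
    show "(\<Phi> has_vector_derivative c * \<bar>x - x0\<bar> ^ Suc n * s ^ n) (at s)"
      unfolding \<Phi>_def has_real_derivative_iff_has_vector_derivative[symmetric]
      by (auto intro!: derivative_eq_intros simp del: power_Suc of_nat_Suc)
    have "\<bar>D' (\<gamma> s)\<bar> * \<bar>x - x0\<bar> \<le> c * \<bar>\<gamma> s - x0\<bar> ^ n * \<bar>x - x0\<bar>"
      using s by (intro mult_right_mono assms(3) \<gamma>) auto
    then show "norm (D' (\<gamma> s) * (x - x0)) \<le> c * \<bar>x - x0\<bar> ^ Suc n * s ^ n"
      using s by (simp add: \<gamma>_def abs_mult power_mult_distrib mult_ac)
  qed simp
  then show ?thesis by (simp add: \<gamma>_def \<Phi>_def)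
qed

text \<open>
  The top derivative \<open>g n\<close> enters only through its oscillation on the segment, which is what a Hoelder
  condition on it bounds. The derivatives are taken within \<open>S\<close>, so that the endpoints of an interval
  are allowed. The induction applies the formula to the derivative and integrates.
\<close>

lemma taylor_remainder_bound:
  fixes g :: "nat \<Rightarrow> real \<Rightarrow> real"
  assumes "\<And>i t. i < n \<Longrightarrow> t \<in> S \<Longrightarrow> (g i has_real_derivative g (Suc i) t) (at t within S)"
    and "closed_segment x0 x \<subseteq> S"
    and "\<And>t. t \<in> closed_segment x0 x \<Longrightarrow> \<bar>g n t - g n x0\<bar> \<le> B"
  shows "\<bar>g 0 x - (\<Sum>i\<le>n. g i x0 / fact i * (x - x0) ^ i)\<bar> \<le> B * \<bar>x - x0\<bar> ^ n / fact n"
  using assms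
proof (induction n arbitrary: g x)
  case 0
  then show ?case by (auto simp: ends_in_segment)
next
  case (Suc n)
  define D where "D t = g 0 t - (\<Sum>i\<le>Suc n. g i x0 / fact i * (t - x0) ^ i)" for t
  define D' where "D' t = g 1 t - (\<Sum>i\<le>n. g (Suc i) x0 / fact i * (t - x0) ^ i)" for t
  have "\<bar>D x - D x0\<bar> \<le> B / fact n * \<bar>x - x0\<bar> ^ Suc n / real (Suc n)"
  proof (rule abs_diff_le_of_deriv_power_bound[OF _ Suc.prems(2)])
    fix t assume t: "t \<in> closed_segment x0 x"
    have sub: "closed_segment x0 t \<subseteq> closed_segment x0 x"
      using t by (simp add: subset_closed_segment)
    have "((\<lambda>t. \<Sum>i\<le>n. g (Suc i) x0 / fact (Suc i) * (t - x0) ^ Suc i) has_real_derivative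
        (\<Sum>i\<le>n. g (Suc i) x0 / fact i * (t - x0) ^ i)) (at t within S)"
    proof (rule DERIV_sum)
      fix i
      have "((\<lambda>t. g (Suc i) x0 / fact (Suc i) * (t - x0) ^ Suc i) has_real_derivative
        g (Suc i) x0 / fact (Suc i) * (real (Suc i) * (t - x0) ^ i)) (at t within S)"
        by (auto intro!: derivative_eq_intros simp del: power_Suc of_nat_Suc fact_Suc)
      then show "((\<lambda>t. g (Suc i) x0 / fact (Suc i) * (t - x0) ^ Suc i) has_real_derivative
        g (Suc i) x0 / fact i * (t - x0) ^ i) (at t within S)"
        by (simp add: fact_Suc del: power_Suc of_nat_Suc)
    qed
    moreover have "(g 0 has_real_derivative g 1 t) (at t within S)"
      using Suc.prems(1)[of 0 t] t Suc.prems(2) by auto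
    moreover have "D = (\<lambda>t. g 0 t - (g 0 x0 + (\<Sum>i\<le>n. g (Suc i) x0 / fact (Suc i) * (t - x0) ^ Suc i)))"
      unfolding D_def by (subst sum.atMost_Suc_shift) simp
    ultimately show "(D has_real_derivative D' t) (at t within S)"
      unfolding D'_def by (auto intro: DERIV_diff DERIV_add[OF DERIV_const, simplified])
    have "\<bar>g (Suc 0) t - (\<Sum>i\<le>n. g (Suc i) x0 / fact i * (t - x0) ^ i)\<bar> \<le> B * \<bar>t - x0\<bar> ^ n / fact n"
      using Suc.prems sub by (intro Suc.IH[of "\<lambda>i. g (Suc i)"]) auto
    then show "\<bar>D' t\<bar> \<le> B / fact n * \<bar>t - x0\<bar> ^ n"
      by (simp add: D'_def)
  qed
  moreover have "D x0 = 0"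
    unfolding D_def by (subst sum.atMost_Suc_shift) simp
  ultimately show ?case
    by (simp add: D_def field_simps del: power_Suc sum.atMost_Suc)
qed

section \<open>Functions with finite flatness norm\<close>

lemma has_real_derivative_nderiv01:
  assumes "n_times_differentiable01 n f" "i < n" "t \<in> {0..1}"
  shows "(nderiv01 i f has_real_derivative nderiv01 (Suc i) f t) (at t within {0..1})"
proof -
  have "nderiv01 i f differentiable (at t within {0..1})"
    using assms by (auto simp: n_times_differentiable01_def differentiable_on_def)
  then show ?thesis
    by (simp add: vector_derivative_works deriv01_def has_real_derivative_iff_has_vector_derivative)
qed

lemma F_norm_finite: "f \<in> F_space \<beta> \<Longrightarrow> ennreal (enn2real (F_norm \<beta> f)) = F_norm \<beta> f"
  by (simp add: F_space_def ennreal_enn2real_if less_top)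

lemma F_space_abs_le:
  assumes "f \<in> F_space \<beta>" "x \<in> {0..1}"
  shows "\<bar>f x\<bar> \<le> enn2real (F_norm \<beta> f)"
proof -
  have "ennreal \<bar>f x\<bar> \<le> sup_norm01 f"
    unfolding sup_norm01_def using assms(2) by (intro SUP_upper)
  also have "\<dots> \<le> F_norm \<beta> f"
    unfolding F_norm_def C_norm_def by (simp add: add.assoc add_increasing2)
  finally show ?thesis
    using F_norm_finite[OF assms(1)] by (metis enn2real_nonneg ennreal_le_iff)
qed

lemma F_space_hoelder:
  assumes "f \<in> F_space \<beta>" "x \<in> {0..1}" "y \<in> {0..1}"
  shows "\<bar>nderiv01 (sfloor \<beta>) f x - nderiv01 (sfloor \<beta>) f y\<bar>
           \<le> enn2real (F_norm \<beta> f) * \<bar>x - y\<bar> powr (\<beta> - real (sfloor \<beta>))"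
proof (cases "x = y")
  case False
  let ?d = "\<bar>nderiv01 (sfloor \<beta>) f x - nderiv01 (sfloor \<beta>) f y\<bar>"
  let ?p = "\<bar>x - y\<bar> powr (\<beta> - real (sfloor \<beta>))"
  have "ennreal (?d / ?p) \<le> C_seminorm \<beta> f"
    unfolding C_seminorm_def using assms(2,3) False by (intro SUP_upper2[of "(x, y)"]) auto
  also have "\<dots> \<le> F_norm \<beta> f"
    unfolding F_norm_def C_norm_def by (simp add: add_increasing add_increasing2)
  finally have "?d / ?p \<le> enn2real (F_norm \<beta> f)"
    using F_norm_finite[OF assms(1)] by (metis enn2real_nonneg ennreal_le_iff)
  then show ?thesis
    using False by (simp add: pos_divide_le_eq)
qed simp

lemma F_space_continuous_on:
  assumes "0 < \<beta>" "f \<in> F_space \<beta>"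
  shows "continuous_on {0..1} f"
proof (cases "sfloor \<beta> = 0")
  case True
  have "(f \<longlongrightarrow> f x) (at x within {0..1})" if x: "x \<in> {0..1}" for x
  proof -
    have "((\<lambda>y. f y - f x) \<longlongrightarrow> 0) (at x within {0..1})"
    proof (rule Lim_null_comparison)
      show "\<forall>\<^sub>F y in at x within {0..1}. norm (f y - f x) \<le> enn2real (F_norm \<beta> f) * \<bar>y - x\<bar> powr \<beta>"
        using F_space_hoelder[OF assms(2) _ x] True by (auto simp: eventually_at_filter)
      have "((\<lambda>y. \<bar>y - x\<bar>) \<longlongrightarrow> 0) (at x within {0..1})"
        by (auto intro!: tendsto_eq_intros)
      then have "((\<lambda>y. \<bar>y - x\<bar> powr \<beta>) \<longlongrightarrow> 0) (at x within {0..1})"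
        using assms(1) by (intro tendsto_eq_rhs[OF tendsto_powr'[OF _ tendsto_const]]) auto
      then show "((\<lambda>y. enn2real (F_norm \<beta> f) * \<bar>y - x\<bar> powr \<beta>) \<longlongrightarrow> 0) (at x within {0..1})"
        by (rule tendsto_mult_right_zero)
    qed
    then show ?thesis by (rule LIM_zero_cancel)
  qed
  then show ?thesis by (auto simp: continuous_on_def)
next
  case False
  then have "(f has_real_derivative nderiv01 (Suc 0) f t) (at t within {0..1})" if "t \<in> {0..1}" for t
    using has_real_derivative_nderiv01[of "sfloor \<beta>" f 0 t] assms(2) that
    by (auto simp: F_space_def C_space_def)
  then show ?thesis by (rule DERIV_continuous_on)
qed

text \<open>
  This is the flatness condition in scale-free form: with \<open>\<rho> = (f(x)/F)\<^bsup>1/\<beta>\<^esup>\<close> it says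
  \<open>\<bar>f\<^sup>(\<^sup>j\<^sup>)(x)\<bar> \<le> f(x)/\<rho>\<^sup>j\<close>. The seminorm is an infimum over \<open>\<kappa>\<close> that need not be attained a priori, but
  \<open>f(x) > 0\<close> makes the sup norm positive, so the full norm \<open>F\<close> exceeds the infimum strictly and some
  admissible \<open>\<kappa>\<close> lies below it.
\<close>

lemma F_space_flat:
  assumes "0 < \<beta>" "f \<in> F_space \<beta>" "x \<in> {0..1}" "0 < f x" "j \<in> {1..sfloor \<beta>}"
  shows "\<bar>nderiv01 j f x\<bar> * ((f x / enn2real (F_norm \<beta> f)) powr (1 / \<beta>)) ^ j \<le> f x"
proof -
  define F where "F = enn2real (F_norm \<beta> f)"
  have F: "0 < F" using F_space_abs_le[OF assms(2,3)] assms(4) by (simp add: F_def)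
  have j: "1 \<le> j" "real j < \<beta>"
    using assms(1,5) le_sfloor_iff[OF assms(1), of j] by auto
  have "ennreal (f x) \<le> sup_norm01 f"
    unfolding sup_norm01_def using assms(3,4) by (intro SUP_upper2[of x]) auto
  also have "\<dots> \<le> C_norm \<beta> f" unfolding C_norm_def by (simp add: add.assoc add_increasing2)
  finally have "0 < C_norm \<beta> f" using assms(4) by (metis ennreal_less_zero_iff leD linorder_not_less not_gr_zero)
  then have "F_seminorm \<beta> f < F_norm \<beta> f"
    using assms(2) unfolding F_norm_def F_space_def
    using ennreal_add_left_cancel_less[of "F_seminorm \<beta> f" 0 "C_norm \<beta> f"]
    by (auto simp: add.commute)
  then obtain \<kappa> where \<kappa>: "0 \<le> \<kappa>" "ennreal \<kappa> < F_norm \<beta> f"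
    "\<bar>nderiv01 j f x\<bar> powr \<beta> \<le> \<kappa> ^ j * \<bar>f x\<bar> powr (\<beta> - real j)"
    unfolding F_seminorm_def INF_less_iff using j assms(3) by blast
  have "\<kappa> \<le> F"
    using \<kappa>(1,2) F_norm_finite[OF assms(2)] F unfolding F_def by (metis ennreal_le_iff less_imp_le)
  then have "\<kappa> ^ j \<le> F ^ j" using \<kappa>(1) by (rule power_mono)
  have "(\<bar>nderiv01 j f x\<bar> * ((f x / F) powr (1 / \<beta>)) ^ j) powr \<beta> = \<bar>nderiv01 j f x\<bar> powr \<beta> * (f x / F) ^ j"
    using assms(1,4) F by (simp add: powr_mult powr_powr mult.commute flip: powr_realpow)
  also have "\<dots> \<le> (F ^ j * f x powr (\<beta> - real j)) * (f x / F) ^ j"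
    using \<kappa>(3) \<open>\<kappa> ^ j \<le> F ^ j\<close> assms(4) F
    by (intro mult_right_mono order_trans[OF \<kappa>(3)] mult_mono) auto
  also have "\<dots> = f x powr \<beta>"
    using F assms(4) by (simp add: power_divide powr_diff powr_realpow)
  finally show ?thesis
    using powr_less_mono2[OF assms(1)] assms(4) unfolding F_def by (meson less_imp_le linorder_not_less)
qed

lemma sum_power_fact_le_exp:
  fixes s :: real
  assumes "0 \<le> s"
  shows "(\<Sum>j\<in>{1..n}. s ^ j / fact j) \<le> exp s - 1"
proof -
  have "(\<Sum>j<Suc n. s ^ j / fact j) \<le> (\<Sum>j. s ^ j / fact j)"
    using assms summable_exp_generic[of s]
    by (intro sum_le_suminf) (auto simp: divide_inverse mult.commute)
  also have "\<dots> = exp s" by (simp add: exp_def divide_inverse mult.commute)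
  also have "(\<Sum>j<Suc n. s ^ j / fact j) = 1 + (\<Sum>j\<in>{1..n}. s ^ j / fact j)"
    by (simp add: lessThan_Suc_atMost atMost_atLeast0 sum.atLeast_Suc_atMost)
  finally show ?thesis by simp
qed

text \<open>
  The first summand pays for the Taylor remainder of \<open>f\<close>; the second is the constant of
  \<open>powr_comp_poly_approx\<close> with \<open>B = 2\<close>, which bounds \<open>e - 1\<close>.
\<close>

definition approx_const :: "nat \<Rightarrow> real" where
  "approx_const n = 2 + (2 * 2 ^ Suc n + (\<Sum>i\<le>n. 2 ^ i))"

text \<open>
  The core of the proof: on the scale \<open>\<rho>\<close> the power \<open>f\<^sup>\<alpha>\<close> is as well approximated by polynomials of
  degree at most \<open>n\<close> as \<open>f\<close> itself, relative to its size at \<open>x\<^sub>0\<close>.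
\<close>

lemma F_space_powr_poly_approx:
  fixes \<alpha> \<beta> a x0 :: real and f :: "real \<Rightarrow> real"
  defines "F \<equiv> enn2real (F_norm \<beta> f)" and "\<rho> \<equiv> (f x0 / enn2real (F_norm \<beta> f)) powr (1 / \<beta>)"
  assumes \<alpha>: "0 \<le> \<alpha>" "\<alpha> \<le> 1" and \<beta>: "0 < \<beta>" and f: "f \<in> F_space \<beta>"
    and x0: "x0 \<in> {0..1}" "0 < f x0"
    and a: "0 < a" "(exp a - 1) + a powr \<beta> / fact (sfloor \<beta>) \<le> 1 / 2"
  shows "\<exists>p. degree p \<le> sfloor \<beta> \<and> (\<forall>x\<in>{0..1}. \<bar>x - x0\<bar> \<le> a * \<rho> \<longrightarrow>
           \<bar>f x powr \<alpha> - poly p x\<bar> \<le> approx_const (sfloor \<beta>) * f x0 powr \<alpha> * (\<bar>x - x0\<bar> / \<rho>) powr \<beta>)"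
proof -
  define n where "n = sfloor \<beta>"
  define c where "c j = nderiv01 j f x0 * \<rho> ^ j / (fact j * f x0)" for j
  define q where "q = (\<Sum>j\<in>{1..n}. monom (c j) j)"
  have F: "0 < F" using F_space_abs_le[OF f x0(1)] x0(2) by (simp add: F_def)
  have \<rho>: "0 < \<rho>" using F x0 by (simp add: \<rho>_def F_def)
  have \<rho>_powr: "\<rho> powr \<beta> = f x0 / F" using \<beta> F x0 by (simp add: \<rho>_def F_def powr_powr)
  have n: "real n < \<beta>" "\<beta> \<le> real (Suc n)"
    using le_sfloor_iff[OF \<beta>, of n] le_sfloor_iff[OF \<beta>, of "Suc n"] by (auto simp: n_def)
  have a1: "a \<le> 1"
    using a exp_ge_add_one_self[of a] powr_ge_zero[of a \<beta>]
    by (smt (verit) divide_nonneg_pos fact_gt_zero field_sum_of_halves)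
  have c: "\<bar>c j\<bar> \<le> 1 / fact j" if "j \<in> {1..n}" for j
  proof -
    have "\<bar>nderiv01 j f x0\<bar> * \<rho> ^ j \<le> f x0"
      using F_space_flat[OF \<beta> f x0] that by (simp add: n_def \<rho>_def)
    then show ?thesis
      using \<rho> x0(2) by (simp add: c_def abs_mult power_abs field_simps)
  qed
  have poly_q: "poly q t = (\<Sum>j\<in>{1..n}. c j * t ^ j)" for t
    by (simp add: q_def poly_sum poly_monom)
  have "coeff_l1 q \<le> (\<Sum>j\<in>{1..n}. 1 ^ j / fact j)"
    unfolding q_def using c by (intro order_trans[OF coeff_l1_sum] sum_mono) (simp add: coeff_l1_monom)
  also have "\<dots> \<le> 2"
    using sum_power_fact_le_exp[of 1 n] exp_le by simp
  finally have q_l1: "coeff_l1 q \<le> 2" .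
  have "coeff q 0 = 0" by (auto simp: q_def coeff_sum coeff_monom)
  then obtain p where p: "degree p \<le> n"
    "\<And>t. \<bar>t\<bar> \<le> 1 \<Longrightarrow> \<bar>poly q t\<bar> \<le> 1 / 2 \<Longrightarrow>
      \<bar>(1 + poly q t) powr \<alpha> - poly p t\<bar> \<le> (2 * 2 ^ Suc n + (\<Sum>i\<le>n. 2 ^ i)) * \<bar>t\<bar> ^ Suc n"
    using powr_comp_poly_approx[OF \<alpha> _ q_l1, of n] by blast
  \<comment> \<open>The approximation is carried from \<open>t\<close> back to \<open>x = x\<^sub>0 + \<rho> t\<close>.\<close>
  define p' where "p' = smult (f x0 powr \<alpha>) (pcompose p [:- x0 / \<rho>, 1 / \<rho>:])"
  have "degree p' \<le> n"
    using p(1) order_trans[OF degree_smult_le degree_pcompose_le[of p "[:- x0 / \<rho>, 1 / \<rho>:]"]] \<rho>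
    by (simp add: p'_def degree_pcompose)
  moreover have "\<bar>f x powr \<alpha> - poly p' x\<bar> \<le> approx_const n * f x0 powr \<alpha> * (\<bar>x - x0\<bar> / \<rho>) powr \<beta>"
    if x: "x \<in> {0..1}" "\<bar>x - x0\<bar> \<le> a * \<rho>" for x
  proof -
    define t where "t = (x - x0) / \<rho>"
    define r where "r = f x / f x0 - (1 + poly q t)"
    have abs_t: "\<bar>t\<bar> = \<bar>x - x0\<bar> / \<rho>" using \<rho> by (simp add: t_def)
    then have t: "\<bar>t\<bar> \<le> a" "\<bar>t\<bar> \<le> 1" using x(2) \<rho> a1 by (auto simp: pos_divide_le_eq intro: order_trans)
    have taylor: "\<bar>f x - (\<Sum>i\<le>n. nderiv01 i f x0 / fact i * (x - x0) ^ i)\<bar>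
        \<le> F * \<bar>x - x0\<bar> powr (\<beta> - real n) * \<bar>x - x0\<bar> ^ n / fact n"
    proof -
      have seg: "closed_segment x0 x \<subseteq> {0..1}"
        using x0(1) x(1) by (intro closed_segment_subset) auto
      have "\<bar>nderiv01 n f s - nderiv01 n f x0\<bar> \<le> F * \<bar>x - x0\<bar> powr (\<beta> - real n)"
        if s: "s \<in> closed_segment x0 x" for s
      proof -
        have "\<bar>nderiv01 n f s - nderiv01 n f x0\<bar> \<le> F * \<bar>s - x0\<bar> powr (\<beta> - real n)"
          using F_space_hoelder[OF f, of s x0] seg s x0(1) by (auto simp: F_def n_def)
        also have "\<dots> \<le> F * \<bar>x - x0\<bar> powr (\<beta> - real n)"
          using F n(1) segment_bound1[OF s] by (intro mult_left_mono powr_mono2) auto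
        finally show ?thesis .
      qed
      then have "\<bar>nderiv01 0 f x - (\<Sum>i\<le>n. nderiv01 i f x0 / fact i * (x - x0) ^ i)\<bar>
          \<le> F * \<bar>x - x0\<bar> powr (\<beta> - real n) * \<bar>x - x0\<bar> ^ n / fact n"
        using f seg by (intro taylor_remainder_bound[where S = "{0..1}"] has_real_derivative_nderiv01[of n])
          (auto simp: F_space_def C_space_def n_def)
      then show ?thesis by simp
    qed
    have sum_eq: "(\<Sum>i\<le>n. nderiv01 i f x0 / fact i * (x - x0) ^ i) = f x0 * (1 + poly q t)"
    proof -
      have "nderiv01 i f x0 / fact i * (x - x0) ^ i = f x0 * (c i * t ^ i)" for i
        using \<rho> x0(2) by (simp add: c_def t_def power_divide)
      then have "(\<Sum>i\<le>n. nderiv01 i f x0 / fact i * (x - x0) ^ i) = f x0 * (\<Sum>i\<le>n. c i * t ^ i)"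
        by (simp only: sum_distrib_left)
      also have "(\<Sum>i\<le>n. c i * t ^ i) = c 0 + poly q t"
        by (simp add: poly_q atMost_atLeast0 sum.atLeast_Suc_atMost)
      also have "c 0 = 1" using x0(2) by (simp add: c_def)
      finally show ?thesis .
    qed
    \<comment> \<open>In units of \<open>\<rho>\<close> the Taylor remainder becomes \<open>f(x\<^sub>0) \<bar>t\<bar>\<^sup>\<beta> / n!\<close>, since \<open>\<rho>\<^sup>\<beta> = f(x\<^sub>0)/F\<close>.\<close>
    have "\<bar>x - x0\<bar> powr (\<beta> - real n) * \<bar>x - x0\<bar> ^ n = \<bar>x - x0\<bar> powr \<beta>"
      using n(1) by (cases "x = x0") (auto simp: powr_diff powr_realpow)
    then have "F * \<bar>x - x0\<bar> powr (\<beta> - real n) * \<bar>x - x0\<bar> ^ n / fact n = f x0 * (\<bar>t\<bar> powr \<beta> / fact n)"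
      using F \<rho> x0(2) by (simp add: abs_t powr_divide \<rho>_powr mult.assoc)
    with taylor sum_eq have "\<bar>f x0 * r\<bar> \<le> f x0 * (\<bar>t\<bar> powr \<beta> / fact n)"
      using x0(2) by (simp add: r_def right_diff_distrib)
    then have r: "\<bar>r\<bar> \<le> \<bar>t\<bar> powr \<beta> / fact n"
      using x0(2) by (simp only: abs_mult abs_of_pos mult_le_cancel_left_pos)
    have "\<bar>poly q t\<bar> \<le> (\<Sum>j\<in>{1..n}. \<bar>c j * t ^ j\<bar>)"
      unfolding poly_q by (rule sum_abs)
    also have "\<dots> \<le> (\<Sum>j\<in>{1..n}. a ^ j / fact j)"
    proof (rule sum_mono)
      fix j assume "j \<in> {1..n}"
      then have "\<bar>c j\<bar> * \<bar>t\<bar> ^ j \<le> 1 / fact j * a ^ j"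
        using t(1) by (intro mult_mono c power_mono) auto
      then show "\<bar>c j * t ^ j\<bar> \<le> a ^ j / fact j"
        by (simp add: abs_mult power_abs)
    qed
    also have "\<dots> \<le> exp a - 1" using a(1) by (intro sum_power_fact_le_exp) auto
    finally have q1: "\<bar>poly q t\<bar> \<le> exp a - 1" .
    have r1: "\<bar>r\<bar> \<le> a powr \<beta> / fact n"
      using t(1) \<beta> by (intro order_trans[OF r] divide_right_mono powr_mono2) auto
    \<comment> \<open>The condition on \<open>a\<close> keeps \<open>1 + q\<close> and \<open>1 + q + r\<close> above \<open>1/2\<close>, away from the singularity of the power.\<close>
    have q_half: "\<bar>poly q t\<bar> \<le> 1 / 2" and qr_half: "\<bar>poly q t\<bar> + \<bar>r\<bar> \<le> 1 / 2"
      using q1 r1 a(2) abs_ge_zero[of r] unfolding n_def by linarith+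
    have fx: "f x = f x0 * (1 + poly q t + r)" using x0(2) by (simp add: r_def)
    have "1 / 2 \<le> 1 + poly q t + r" "1 / 2 \<le> 1 + poly q t" using q_half qr_half by linarith+
    from powr_diff_le[OF \<alpha> this]
    have "\<bar>(1 + poly q t + r) powr \<alpha> - (1 + poly q t) powr \<alpha>\<bar> \<le> 2 * \<bar>r\<bar>" by simp
    also have "\<dots> \<le> 2 * \<bar>t\<bar> powr \<beta>"
      using r divide_left_mono[of 1 "fact n" "\<bar>t\<bar> powr \<beta>"] fact_ge_1[of n] by simp
    finally have e1: "\<bar>(1 + poly q t + r) powr \<alpha> - (1 + poly q t) powr \<alpha>\<bar> \<le> 2 * \<bar>t\<bar> powr \<beta>" .
    have "\<bar>t\<bar> ^ Suc n \<le> \<bar>t\<bar> powr \<beta>"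
    proof (cases "t = 0")
      case False
      then have "\<bar>t\<bar> ^ Suc n = \<bar>t\<bar> powr real (Suc n)" by (subst powr_realpow) auto
      also have "\<dots> \<le> \<bar>t\<bar> powr \<beta>" using n(2) t(2) False by (intro powr_mono') auto
      finally show ?thesis .
    qed simp
    then have "(2 * 2 ^ Suc n + (\<Sum>i\<le>n. 2 ^ i)) * \<bar>t\<bar> ^ Suc n
        \<le> (2 * 2 ^ Suc n + (\<Sum>i\<le>n. 2 ^ i)) * \<bar>t\<bar> powr \<beta>"
      by (intro mult_left_mono) (auto intro!: add_nonneg_nonneg sum_nonneg)
    with p(2)[OF t(2) q_half] e1
    have "\<bar>(1 + poly q t + r) powr \<alpha> - poly p t\<bar> \<le> approx_const n * \<bar>t\<bar> powr \<beta>"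
      unfolding approx_const_def distrib_right by linarith
    then have "f x0 powr \<alpha> * \<bar>(1 + poly q t + r) powr \<alpha> - poly p t\<bar>
        \<le> f x0 powr \<alpha> * (approx_const n * \<bar>t\<bar> powr \<beta>)"
      by (rule mult_left_mono) simp
    moreover have "f x powr \<alpha> - poly p' x = f x0 powr \<alpha> * ((1 + poly q t + r) powr \<alpha> - poly p t)"
    proof -
      have "f x powr \<alpha> = f x0 powr \<alpha> * (1 + poly q t + r) powr \<alpha>"
        unfolding fx by (rule powr_mult)
      moreover have "poly p' x = f x0 powr \<alpha> * poly p t"
        by (simp add: p'_def poly_pcompose t_def diff_divide_distrib)
      ultimately show ?thesis by (simp add: right_diff_distrib)
    qed
    ultimately show ?thesis
      by (simp add: abs_mult abs_t mult_ac)
  qed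
  ultimately show ?thesis unfolding n_def by blast
qed

lemma approx_const_nonneg: "0 \<le> approx_const n"
  unfolding approx_const_def by (auto intro!: add_nonneg_nonneg sum_nonneg)

section \<open>Wavelet coefficients of powers\<close>

context interval_wavelet_basis
begin

lemma K_nonneg:
  assumes "k \<in> I j"
  shows "0 \<le> K"
proof -
  have "0 \<le> K * 2 powr (real j / 2)"
    using sup_bound[OF assms, of 0] by (rule order_trans[rotated]) auto
  then show ?thesis by (simp add: zero_le_mult_iff)
qed

lemma integrable_mult_wavelet:
  assumes k: "k \<in> I j" and h: "continuous_on {0..1} h"
  shows "integrable (lebesgue_on {0..1}) (\<lambda>x. h x * \<Psi> j k x)"
proof -
  have "Inr (j, k) \<in> I0 <+> Sigma UNIV I" using k by auto
  with basis_interval[unfolded orthonormal_basis_L2_def, THEN conjunct1]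
  have "square_integrable_on (case_sum \<Phi> (\<lambda>(j, k). \<Psi> j k) (Inr (j, k))) {0..1}"
    by (rule bspec)
  then have meas: "\<Psi> j k \<in> borel_measurable (lebesgue_on {0..1})"
    by (simp add: square_integrable_on_def)
  have "bounded (h ` {0..1})"
    by (intro compact_imp_bounded compact_continuous_image h) simp
  then obtain B where "\<forall>x\<in>{0..1}. \<bar>h x\<bar> \<le> B"
    by (auto simp: bounded_iff)
  then have B: "\<bar>h x\<bar> \<le> B" if "x \<in> {0..1}" for x
    using that by blast
  interpret finite_measure "lebesgue_on {0..1::real}"
    by (rule finite_measure_lebesgue_on) simp
  show ?thesis
  proof (rule integrable_const_bound[of _ "B * (K * 2 powr (real j / 2))"])
    have "\<bar>h x\<bar> * \<bar>\<Psi> j k x\<bar> \<le> B * (K * 2 powr (real j / 2))" if "x \<in> {0..1}" for x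
      using B[OF that] sup_bound[OF k that] by (intro mult_mono) auto
    then show "AE x in lebesgue_on {0..1}. norm (h x * \<Psi> j k x) \<le> B * (K * 2 powr (real j / 2))"
      by (intro AE_I2) (simp add: abs_mult)
    show "(\<lambda>x. h x * \<Psi> j k x) \<in> borel_measurable (lebesgue_on {0..1})"
      by (intro borel_measurable_times meas continuous_imp_measurable_on_sets_lebesgue h) simp
  qed
qed

lemma inner_poly_wavelet:
  assumes k: "k \<in> I j" and p: "degree p < S"
  shows "(LINT x|lebesgue_on {0..1}. poly p x * \<Psi> j k x) = 0"
proof -
  have "(LINT x|lebesgue_on {0..1}. poly p x * \<Psi> j k x)
      = (LINT x|lebesgue_on {0..1}. (\<Sum>i\<le>degree p. coeff p i * (x ^ i * \<Psi> j k x)))"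
    by (simp add: poly_altdef sum_distrib_right mult.assoc)
  also have "\<dots> = (\<Sum>i\<le>degree p. LINT x|lebesgue_on {0..1}. coeff p i * (x ^ i * \<Psi> j k x))"
    by (intro Bochner_Integration.integral_sum integrable_mult_right integrable_mult_wavelet[OF k])
       (intro continuous_intros)
  also have "\<dots> = 0"
    using moments_interval[OF k] p by (intro sum.neutral) auto
  finally show ?thesis .
qed

text \<open>
  Subtracting a polynomial of degree below \<open>S\<close> leaves the coefficient unchanged; what remains is
  bounded by sup norm of the difference times sup norm of the wavelet times length of the support.
\<close>

lemma coefficient_le_poly_error:
  assumes k: "k \<in> I j" and g: "continuous_on {0..1} g" and p: "degree p < S"
    and uv: "0 \<le> u" "u \<le> v" "v \<le> 1" "supp_on {0..1} (\<Psi> j k) \<subseteq> {u..v}"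
    and E: "\<And>x. x \<in> {u..v} \<Longrightarrow> \<bar>g x - poly p x\<bar> \<le> E"
  shows "\<bar>inner_L2 {0..1} g (\<Psi> j k)\<bar> \<le> E * (K * 2 powr (real j / 2)) * (v - u)"
proof -
  let ?M = "lebesgue_on {0..1::real}"
  let ?b = "E * (K * 2 powr (real j / 2))"
  have cont: "continuous_on {0..1} (\<lambda>x. g x - poly p x)"
    by (intro continuous_intros g)
  have "inner_L2 {0..1} g (\<Psi> j k)
      = (LINT x|?M. g x * \<Psi> j k x) - (LINT x|?M. poly p x * \<Psi> j k x)"
    by (simp add: inner_L2_def inner_poly_wavelet[OF k p])
  also have "\<dots> = (LINT x|?M. (g x - poly p x) * \<Psi> j k x)"
    unfolding left_diff_distrib
    by (intro Bochner_Integration.integral_diff[symmetric] integrable_mult_wavelet[OF k] g)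
       (intro continuous_intros)
  finally have eq: "inner_L2 {0..1} g (\<Psi> j k) = (LINT x|?M. (g x - poly p x) * \<Psi> j k x)" .
  interpret finite_measure ?M
    by (rule finite_measure_lebesgue_on) simp
  have uv_sets: "{u..v} \<in> sets ?M"
    using uv by (auto simp: sets_restrict_space_iff)
  have "norm (LINT x|?M. (g x - poly p x) * \<Psi> j k x) \<le> (LINT x|?M. ?b * indicator {u..v} x)"
  proof (rule Bochner_Integration.integral_norm_bound_integral[OF integrable_mult_wavelet[OF k cont]])
    show "integrable ?M (\<lambda>x. ?b * indicator {u..v} x)"
      using uv_sets by (intro integrable_mult_right integrable_real_indicator)
        (simp_all add: emeasure_finite less_top[symmetric])
    fix x assume "x \<in> space ?M"
    then have x: "x \<in> {0..1}" by simp
    show "norm ((g x - poly p x) * \<Psi> j k x) \<le> ?b * indicator {u..v} x"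
    proof (cases "x \<in> {u..v}")
      case True
      then have "\<bar>g x - poly p x\<bar> * \<bar>\<Psi> j k x\<bar> \<le> ?b"
        using E[OF True] sup_bound[OF k x] by (intro mult_mono) auto
      then show ?thesis using True by (simp add: abs_mult)
    next
      case False
      have "{x \<in> {0..1}. \<Psi> j k x \<noteq> 0} \<subseteq> {u..v}"
        using closure_subset uv(4) unfolding supp_on_def by (rule order_trans)
      with False x have "\<Psi> j k x = 0" by auto
      then show ?thesis using False by simp
    qed
  qed
  also have "\<dots> = ?b * measure ?M {u..v}"
    using uv by (simp add: Int_absorb2 inf.absorb1)
  also have "measure ?M {u..v} = v - u"
    using uv by (simp add: measure_restrict_space measure_completion)
  finally show ?thesis by (simp add: eq)
qed

text \<open>
  The bound \<open>h \<le> a \<rho>\<close> puts the whole support inside the region around \<open>x\<^sub>0\<close> where \<open>f\<^sup>\<alpha>\<close> has a good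
  polynomial approximation.
\<close>

lemma coefficient_bound_near_positive_value:
  fixes \<alpha> \<beta> a x0 h :: real and f :: "real \<Rightarrow> real"
  defines "F \<equiv> enn2real (F_norm \<beta> f)"
  assumes \<alpha>: "0 < \<alpha>" "\<alpha> \<le> 1" and \<beta>: "0 < \<beta>" "\<beta> < real S" and f: "f \<in> F_space \<beta>"
    and a: "0 < a" "(exp a - 1) + a powr \<beta> / fact (sfloor \<beta>) \<le> 1 / 2"
    and k: "k \<in> I j"
    and uv: "0 \<le> u" "u \<le> v" "v \<le> 1" "supp_on {0..1} (\<Psi> j k) \<subseteq> {u..v}"
    and x0: "x0 \<in> {u..v}" "0 < f x0"
    and h: "v - u \<le> h" "h \<le> a * (f x0 / F) powr (1 / \<beta>)"
  shows "\<bar>inner_L2 {0..1} (\<lambda>x. f x powr \<alpha>) (\<Psi> j k)\<bar>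
           \<le> approx_const (sfloor \<beta>) * \<bar>K\<bar> * F * f x0 powr (\<alpha> - 1) * (h powr \<beta> * h * 2 powr (real j / 2))"
proof -
  define \<rho> where "\<rho> = (f x0 / F) powr (1 / \<beta>)"
  let ?A = "approx_const (sfloor \<beta>)"
  have x01: "x0 \<in> {0..1}" using x0 uv by auto
  have F: "0 < F" using F_space_abs_le[OF f x01] x0(2) by (simp add: F_def)
  have \<rho>: "0 < \<rho>" "\<rho> powr \<beta> = f x0 / F"
    using F x0(2) \<beta> by (simp_all add: \<rho>_def powr_powr)
  have h0: "0 \<le> h" using h(1) uv by simp
  obtain p where p: "degree p \<le> sfloor \<beta>"
    "\<And>x. x \<in> {0..1} \<Longrightarrow> \<bar>x - x0\<bar> \<le> a * \<rho> \<Longrightarrow>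
      \<bar>f x powr \<alpha> - poly p x\<bar> \<le> ?A * f x0 powr \<alpha> * (\<bar>x - x0\<bar> / \<rho>) powr \<beta>"
    using F_space_powr_poly_approx[OF less_imp_le[OF \<alpha>(1)] \<alpha>(2) \<beta>(1) f x01 x0(2) a]
    unfolding \<rho>_def F_def by blast
  have "degree p < S"
    using p(1) le_sfloor_iff[OF \<beta>(1), of "sfloor \<beta>"] \<beta>(2) by simp
  moreover have "\<bar>f x powr \<alpha> - poly p x\<bar> \<le> ?A * F * f x0 powr (\<alpha> - 1) * h powr \<beta>"
    if x: "x \<in> {u..v}" for x
  proof -
    have dist: "\<bar>x - x0\<bar> \<le> h" using x x0(1) h(1) by auto
    then have "\<bar>f x powr \<alpha> - poly p x\<bar> \<le> ?A * f x0 powr \<alpha> * (\<bar>x - x0\<bar> / \<rho>) powr \<beta>"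
      using x uv h(2) unfolding \<rho>_def[symmetric] by (intro p(2)) auto
    also have "\<dots> \<le> ?A * f x0 powr \<alpha> * (h / \<rho>) powr \<beta>"
      using dist \<rho>(1) \<beta>(1) approx_const_nonneg
      by (intro mult_left_mono powr_mono2 divide_right_mono) auto
    also have "\<dots> = ?A * F * f x0 powr (\<alpha> - 1) * h powr \<beta>"
      using h0 \<rho> x0(2) F by (simp add: powr_divide powr_diff)
    finally show ?thesis .
  qed
  moreover have "continuous_on {0..1} (\<lambda>x. f x powr \<alpha>)"
    using \<alpha>(1) f F_space_continuous_on[OF \<beta>(1) f]
    by (intro continuous_on_powr' continuous_on_const) (auto simp: F_space_def)
  ultimately have "\<bar>inner_L2 {0..1} (\<lambda>x. f x powr \<alpha>) (\<Psi> j k)\<bar>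
      \<le> ?A * F * f x0 powr (\<alpha> - 1) * h powr \<beta> * (K * 2 powr (real j / 2)) * (v - u)"
    by (intro coefficient_le_poly_error[OF k _ _ uv]) auto
  also have "\<dots> \<le> ?A * F * f x0 powr (\<alpha> - 1) * h powr \<beta> * (K * 2 powr (real j / 2)) * h"
    using h(1) F approx_const_nonneg K_nonneg[OF k] by (intro mult_left_mono) auto
  finally show ?thesis
    using K_nonneg[OF k] by (simp add: mult_ac)
qed

text \<open>
  The threshold \<open>F (h/a)\<^sup>\<beta>\<close> is chosen such that a value of \<open>f\<close> above it is large enough for the
  preceding bound, while a function below it needs no approximation at all: the zero polynomial
  suffices. The bound \<open>h\<close> on the length has to be positive because the second case raises the threshold
  to the power \<open>\<alpha> - 1\<close>.
\<close>

lemma coefficient_bound_uniform: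
  fixes \<alpha> \<beta> a h :: real and f :: "real \<Rightarrow> real"
  defines "F \<equiv> enn2real (F_norm \<beta> f)"
  assumes \<alpha>: "0 < \<alpha>" "\<alpha> \<le> 1" and \<beta>: "0 < \<beta>" "\<beta> < real S" and f: "f \<in> F_space \<beta>"
    and a: "0 < a" "(exp a - 1) + a powr \<beta> / fact (sfloor \<beta>) \<le> 1 / 2"
    and k: "k \<in> I j"
    and uv: "0 \<le> u" "u \<le> v" "v \<le> 1" "supp_on {0..1} (\<Psi> j k) \<subseteq> {u..v}"
    and h: "v - u \<le> h" "0 < h"
  shows "\<bar>inner_L2 {0..1} (\<lambda>x. f x powr \<alpha>) (\<Psi> j k)\<bar>
           \<le> \<bar>K\<bar> * (a powr (- (\<alpha> * \<beta>)) + approx_const (sfloor \<beta>) * a powr (\<beta> * (1 - \<alpha>)))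
               * F powr \<alpha> * (h powr (\<alpha> * \<beta>) * h * 2 powr (real j / 2))"
proof -
  let ?A = "approx_const (sfloor \<beta>)"
  let ?R = "F powr \<alpha> * (h powr (\<alpha> * \<beta>) * h * 2 powr (real j / 2))"
  let ?s = "F * (h / a) powr \<beta>"
  have F: "0 \<le> F" by (simp add: F_def)
  have fpos: "0 \<le> f x" if "x \<in> {u..v}" for x
    using f that uv by (auto simp: F_space_def)
  have bound: "\<bar>inner_L2 {0..1} (\<lambda>x. f x powr \<alpha>) (\<Psi> j k)\<bar>
      \<le> \<bar>K\<bar> * a powr (- (\<alpha> * \<beta>)) * ?R \<or>
    \<bar>inner_L2 {0..1} (\<lambda>x. f x powr \<alpha>) (\<Psi> j k)\<bar> \<le> \<bar>K\<bar> * (?A * a powr (\<beta> * (1 - \<alpha>))) * ?R"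
  proof (cases "\<forall>x\<in>{u..v}. f x \<le> ?s")
    case True
    have "continuous_on {0..1} (\<lambda>x. f x powr \<alpha>)"
      using \<alpha>(1) f F_space_continuous_on[OF \<beta>(1) f]
      by (intro continuous_on_powr' continuous_on_const) (auto simp: F_space_def)
    moreover have "degree (0 :: real poly) < S" using \<beta> by (cases S) auto
    moreover have "\<bar>f x powr \<alpha> - poly 0 x\<bar> \<le> ?s powr \<alpha>" if "x \<in> {u..v}" for x
      using True that fpos \<alpha>(1) by (auto intro!: powr_mono2)
    ultimately have "\<bar>inner_L2 {0..1} (\<lambda>x. f x powr \<alpha>) (\<Psi> j k)\<bar>
        \<le> ?s powr \<alpha> * (K * 2 powr (real j / 2)) * (v - u)"
      by (rule coefficient_le_poly_error[where p = 0, OF k _ _ uv])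
    also have "\<dots> \<le> ?s powr \<alpha> * (K * 2 powr (real j / 2)) * h"
      using h(1) K_nonneg[OF k] by (intro mult_left_mono) auto
    also have "?s powr \<alpha> = F powr \<alpha> * (h powr (\<alpha> * \<beta>) * a powr (- (\<alpha> * \<beta>)))"
      using F h(2) a(1) by (simp add: powr_mult powr_powr powr_divide powr_minus_divide mult.commute)
    finally show ?thesis
      using K_nonneg[OF k] by (simp add: mult_ac)
  next
    case False
    then obtain x1 where x1: "x1 \<in> {u..v}" "?s < f x1" by (auto simp: not_le)
    have "0 \<le> ?s" using F by simp
    then have fx1: "0 < f x1" using x1(2) by linarith
    have "x1 \<in> {0..1}" using x1(1) uv by auto
    then have F0: "0 < F"
      using F_space_abs_le[OF f, of x1] fx1 by (simp add: F_def)
    have s0: "0 < ?s" using F0 h(2) a(1) by simp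
    \<comment> \<open>A value above the threshold has \<open>\<rho> \<ge> h/a\<close>.\<close>
    have "h / a = ((h / a) powr \<beta>) powr (1 / \<beta>)"
      using \<beta>(1) h(2) a(1) by (simp add: powr_powr)
    also have "\<dots> \<le> (f x1 / F) powr (1 / \<beta>)"
      using x1(2) F0 \<beta>(1) by (intro powr_mono2) (auto simp: field_simps)
    finally have "h \<le> a * (f x1 / F) powr (1 / \<beta>)"
      using a(1) by (simp add: field_simps)
    then have "\<bar>inner_L2 {0..1} (\<lambda>x. f x powr \<alpha>) (\<Psi> j k)\<bar>
        \<le> ?A * \<bar>K\<bar> * F * f x1 powr (\<alpha> - 1) * (h powr \<beta> * h * 2 powr (real j / 2))"
      unfolding F_def
      by (intro coefficient_bound_near_positive_value[OF \<alpha> \<beta> f a k uv x1(1) fx1 h(1)])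
    also have "\<dots> \<le> ?A * \<bar>K\<bar> * F * ?s powr (\<alpha> - 1) * (h powr \<beta> * h * 2 powr (real j / 2))"
      using x1(2) s0 \<alpha>(2) F h(2) approx_const_nonneg
      by (intro mult_right_mono mult_left_mono powr_mono2') auto
    also have "\<dots> = ?A * \<bar>K\<bar> * (F * ?s powr (\<alpha> - 1) * h powr \<beta>) * (h * 2 powr (real j / 2))"
      by (simp only: mult_ac)
    also have "F * ?s powr (\<alpha> - 1) * h powr \<beta> = F powr \<alpha> * h powr (\<alpha> * \<beta>) * a powr (\<beta> * (1 - \<alpha>))"
    proof -
      have a_powr: "a powr (\<beta> * (1 - \<alpha>)) = 1 / a powr (\<beta> * (\<alpha> - 1))"
        by (simp add: algebra_simps flip: powr_minus_divide)
      have s_powr: "?s powr (\<alpha> - 1)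
          = F powr (\<alpha> - 1) * h powr (\<beta> * (\<alpha> - 1)) * a powr (\<beta> * (1 - \<alpha>))"
        unfolding a_powr by (simp add: powr_mult powr_powr powr_divide)
      have "F * F powr (\<alpha> - 1) = F powr \<alpha>"
        using F0 by (simp add: powr_diff)
      moreover have "h powr (\<beta> * (\<alpha> - 1)) * h powr \<beta> = h powr (\<alpha> * \<beta>)"
        by (simp add: algebra_simps flip: powr_add)
      moreover have "F * ?s powr (\<alpha> - 1) * h powr \<beta>
          = (F * F powr (\<alpha> - 1)) * (h powr (\<beta> * (\<alpha> - 1)) * h powr \<beta>) * a powr (\<beta> * (1 - \<alpha>))"
        unfolding s_powr by (simp only: mult_ac)
      ultimately show ?thesis by simp
    qed
    finally show ?thesis by (simp add: mult_ac)
  qed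
  have "0 \<le> \<bar>K\<bar> * a powr (- (\<alpha> * \<beta>)) * ?R" "0 \<le> \<bar>K\<bar> * (?A * a powr (\<beta> * (1 - \<alpha>))) * ?R"
    using h(2) approx_const_nonneg by (auto intro!: mult_nonneg_nonneg)
  with bound show ?thesis
    by (auto simp: distrib_left distrib_right mult.assoc)
qed

end

section \<open>The two coefficient bounds\<close>

lemma exists_small_radius:
  assumes "0 < \<beta>"
  shows "\<exists>a>0. (exp a - 1) + a powr \<beta> / fact (sfloor \<beta>) \<le> (1 / 2 :: real)"
proof -
  have "((\<lambda>a. (exp a - 1) + a powr \<beta> / fact (sfloor \<beta>)) \<longlongrightarrow> (exp 0 - 1) + 0 powr \<beta> / fact (sfloor \<beta>)) (at_right 0)"
    using assms by (intro tendsto_intros tendsto_powr') (auto simp: eventually_at_right_less less_imp_le intro!: eventually_at_right_less[THEN eventually_mono])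
  then have "\<forall>\<^sub>F a in at_right 0. (exp a - 1) + a powr \<beta> / fact (sfloor \<beta>) < (1 / 2 :: real)"
    by (rule order_tendstoD) simp
  then have "\<forall>\<^sub>F a in at_right 0. 0 < a \<and> (exp a - 1) + a powr \<beta> / fact (sfloor \<beta>) \<le> (1 / 2 :: real)"
    using eventually_at_right_less[of "0::real"] by eventually_elim auto
  then show ?thesis
    using eventually_happens[of _ "at_right (0::real)"] by (auto simp: trivial_limit_at_right_real)
qed

text \<open>
  If the left-hand side is positive, the set in the definition of the threshold is bounded below and
  its least element is the ceiling of a logarithm. Otherwise, for instance for a support of length zero,
  the set contains all integers and the threshold is an unspecified integer, but then the inequality
  holds for every \<open>j\<close>.
\<close>

lemma j_threshold_le_D:
  assumes "j_threshold \<psi> \<beta> a f x0 \<le> int j"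
  shows "supp_length \<psi> * inverse a * (enn2real (F_norm \<beta> f) / f x0) powr (1 / \<beta>) \<le> 2 ^ j"
proof (cases "0 < supp_length \<psi> * inverse a * (enn2real (F_norm \<beta> f) / f x0) powr (1 / \<beta>)")
  case True
  let ?c = "supp_length \<psi> * inverse a * (enn2real (F_norm \<beta> f) / f x0) powr (1 / \<beta>)"
  have iff: "?c \<le> 2 powr real_of_int m \<longleftrightarrow> \<lceil>log 2 ?c\<rceil> \<le> m" for m
    using True log_le_iff[of 2 ?c "real_of_int m"] by (simp add: ceiling_le_iff)
  have "j_threshold \<psi> \<beta> a f x0 = \<lceil>log 2 ?c\<rceil>"
    unfolding j_threshold_def iff by (rule Least_equality) auto
  with assms have "?c \<le> 2 powr real_of_int (int j)"
    unfolding iff by simp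
  then show ?thesis by (simp add: powr_realpow)
next
  case False
  then show ?thesis by (meson linorder_not_less order_trans zero_le_numeral zero_le_power)
qed

lemma dyadic_scaling:
  fixes L s :: real
  assumes "0 \<le> L"
  shows "(L / 2 ^ j) powr s * (L / 2 ^ j) * 2 powr (real j / 2)
           = L powr s * L * 2 powr (- (real j / 2) * (2 * s + 1))"
proof -
  have "(L / 2 ^ j) powr s = L powr s * 2 powr (- (real j * s))"
    using assms by (simp add: powr_divide powr_powr powr_minus_divide flip: powr_realpow)
  moreover have "L / 2 ^ j = L * 2 powr (- real j)"
    by (simp add: powr_minus_divide powr_realpow)
  moreover have "2 powr (- (real j * s)) * 2 powr (- real j) * 2 powr (real j / 2)
      = 2 powr (- (real j / 2) * (2 * s + 1))"
  proof -
    have "- (real j * s) + - real j + real j / 2 = - (real j / 2) * (2 * s + 1)"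
      by (simp add: field_simps)
    then show ?thesis by (simp only: powr_add[symmetric])
  qed
  ultimately show ?thesis by (simp add: mult_ac)
qed

theorem proposition1:
  fixes \<psi> :: "real \<Rightarrow> real" and K \<alpha> \<beta> :: real
  assumes "0 < \<alpha>" and "\<alpha> \<le> 1" and "0 < \<beta>"
  shows "\<exists>C::real. \<forall>S \<phi> I0 \<Phi> I \<Psi> f.
    regular_wavelet_pair S \<phi> \<psi> \<and> interval_wavelet_basis S \<phi> \<psi> K I0 \<Phi> I \<Psi> \<and>
    \<beta> < real S \<and> f \<in> F_space \<beta> \<longrightarrow>
      (\<forall>j. \<forall>k\<in>I j.
         \<bar>inner_L2 {0..1} (\<lambda>x. f x powr \<alpha>) (\<Psi> j k)\<bar>
           \<le> C * enn2real (F_norm \<beta> f) powr \<alpha> * 2 powr (- (real j / 2) * (2 * \<alpha> * \<beta> + 1))) \<and>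
      (\<forall>a x0. 0 < a \<and> (exp a - 1) + a powr \<beta> / fact (sfloor \<beta>) \<le> 1 / 2 \<and>
         x0 \<in> {0..1} \<and> 0 < f x0 \<longrightarrow>
         (\<forall>j. \<forall>k\<in>I j. j_threshold \<psi> \<beta> a f x0 \<le> int j \<and> x0 \<in> supp_on {0..1} (\<Psi> j k) \<longrightarrow>
           \<bar>inner_L2 {0..1} (\<lambda>x. f x powr \<alpha>) (\<Psi> j k)\<bar>
             \<le> C * (enn2real (F_norm \<beta> f) / f x0 powr (1 - \<alpha>))
                 * 2 powr (- (real j / 2) * (2 * \<beta> + 1))))"
proof -
  \<comment> \<open>The constant is chosen before any basis is given, when neither \<open>K\<close> nor the length of the support
    is known to be nonnegative; hence the absolute values here and in \<open>C1\<close> and \<open>C2\<close>.\<close>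
  define L where "L = \<bar>supp_length \<psi>\<bar>"
  have L: "0 \<le> L" by (simp add: L_def)
  let ?A = "approx_const (sfloor \<beta>)"
  obtain b where b: "0 < b" "(exp b - 1) + b powr \<beta> / fact (sfloor \<beta>) \<le> 1 / 2"
    using exists_small_radius[OF assms(3)] by blast
  \<comment> \<open>Lengths are measured by \<open>L + 1\<close> in \<open>C1\<close> because the uniform bound needs a positive length.\<close>
  define C1 where "C1 = \<bar>K\<bar> * (b powr (- (\<alpha> * \<beta>)) + ?A * b powr (\<beta> * (1 - \<alpha>)))
    * ((L + 1) powr (\<alpha> * \<beta>) * (L + 1))"
  define C2 where "C2 = ?A * \<bar>K\<bar> * (L powr \<beta> * L)"
  have C: "0 \<le> C1" "0 \<le> C2"
    using L approx_const_nonneg by (auto simp: C1_def C2_def intro!: mult_nonneg_nonneg add_nonneg_nonneg)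
  have support_L: "\<exists>u v. 0 \<le> u \<and> u \<le> v \<and> v \<le> 1 \<and> v - u \<le> L / 2 ^ j \<and> supp_on {0..1} (\<Psi> j k) \<subseteq> {u..v}
      \<and> supp_length \<psi> = L"
    if W: "interval_wavelet_basis S \<phi> \<psi> K I0 \<Phi> I \<Psi>" and k: "k \<in> I j" for S \<phi> I0 \<Phi> I \<Psi> j k
  proof -
    obtain u v where uv: "0 \<le> u" "u \<le> v" "v \<le> 1" "v - u \<le> supp_length \<psi> / 2 ^ j"
      "supp_on {0..1} (\<Psi> j k) \<subseteq> {u..v}"
      using interval_wavelet_basis.support[OF W k] by blast
    have "0 \<le> supp_length \<psi> / 2 ^ j" using uv(2,4) by linarith
    then have "0 * 2 ^ j \<le> supp_length \<psi>" by (subst (asm) pos_le_divide_eq) auto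
    then have "supp_length \<psi> = L" by (simp add: L_def)
    with uv show ?thesis by blast
  qed
  have uniform: "\<bar>inner_L2 {0..1} (\<lambda>x. f x powr \<alpha>) (\<Psi> j k)\<bar>
      \<le> (C1 + C2) * enn2real (F_norm \<beta> f) powr \<alpha> * 2 powr (- (real j / 2) * (2 * \<alpha> * \<beta> + 1))"
    if W: "interval_wavelet_basis S \<phi> \<psi> K I0 \<Phi> I \<Psi>" and S: "\<beta> < real S"
      and f: "f \<in> F_space \<beta>" and k: "k \<in> I j" for S \<phi> I0 \<Phi> I \<Psi> f j k
  proof -
    interpret interval_wavelet_basis S \<phi> \<psi> K I0 \<Phi> I \<Psi> by (rule W)
    obtain u v where uv: "0 \<le> u" "u \<le> v" "v \<le> 1" "v - u \<le> L / 2 ^ j"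
      "supp_on {0..1} (\<Psi> j k) \<subseteq> {u..v}"
      using support_L[OF W k] by blast
    have "v - u \<le> (L + 1) / 2 ^ j"
      using uv(4) divide_right_mono[of L "L + 1" "2 ^ j"] by simp
    moreover have "0 < (L + 1) / 2 ^ j" using L by simp
    ultimately have "\<bar>inner_L2 {0..1} (\<lambda>x. f x powr \<alpha>) (\<Psi> j k)\<bar>
        \<le> \<bar>K\<bar> * (b powr (- (\<alpha> * \<beta>)) + ?A * b powr (\<beta> * (1 - \<alpha>))) * enn2real (F_norm \<beta> f) powr \<alpha>
          * (((L + 1) / 2 ^ j) powr (\<alpha> * \<beta>) * ((L + 1) / 2 ^ j) * 2 powr (real j / 2))"
      by (rule coefficient_bound_uniform[OF assms S f b k uv(1-3,5)])
    also have "\<dots> = C1 * enn2real (F_norm \<beta> f) powr \<alpha> * 2 powr (- (real j / 2) * (2 * \<alpha> * \<beta> + 1))"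
      using L dyadic_scaling[of "L + 1" j "\<alpha> * \<beta>"] by (simp add: C1_def mult_ac)
    also have "\<dots> \<le> (C1 + C2) * enn2real (F_norm \<beta> f) powr \<alpha> * 2 powr (- (real j / 2) * (2 * \<alpha> * \<beta> + 1))"
      using C by (intro mult_right_mono) auto
    finally show ?thesis .
  qed
  have near: "\<bar>inner_L2 {0..1} (\<lambda>x. f x powr \<alpha>) (\<Psi> j k)\<bar>
      \<le> (C1 + C2) * (enn2real (F_norm \<beta> f) / f x0 powr (1 - \<alpha>)) * 2 powr (- (real j / 2) * (2 * \<beta> + 1))"
    if W: "interval_wavelet_basis S \<phi> \<psi> K I0 \<Phi> I \<Psi>" and S: "\<beta> < real S"
      and f: "f \<in> F_space \<beta>" and k: "k \<in> I j"
      and a: "0 < a" "(exp a - 1) + a powr \<beta> / fact (sfloor \<beta>) \<le> 1 / 2"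
      and x0: "x0 \<in> {0..1}" "0 < f x0" "x0 \<in> supp_on {0..1} (\<Psi> j k)"
      and j: "j_threshold \<psi> \<beta> a f x0 \<le> int j"
    for S \<phi> I0 \<Phi> I \<Psi> f j k a x0
  proof -
    interpret interval_wavelet_basis S \<phi> \<psi> K I0 \<Phi> I \<Psi> by (rule W)
    define F where "F = enn2real (F_norm \<beta> f)"
    obtain u v where uv: "0 \<le> u" "u \<le> v" "v \<le> 1" "v - u \<le> L / 2 ^ j"
      "supp_on {0..1} (\<Psi> j k) \<subseteq> {u..v}" and L_eq: "supp_length \<psi> = L"
      using support_L[OF W k] by blast
    have x0_uv: "x0 \<in> {u..v}" using uv(5) x0(3) by blast
    have F: "0 < F" using F_space_abs_le[OF f x0(1)] x0(2) by (simp add: F_def)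
    have "L * inverse a * (F / f x0) powr (1 / \<beta>) \<le> 2 ^ j"
      using j_threshold_le_D[OF j] by (simp add: L_eq F_def)
    then have "L / 2 ^ j \<le> a * (f x0 / F) powr (1 / \<beta>)"
      using a(1) F x0(2) by (simp add: powr_divide field_simps)
    then have "\<bar>inner_L2 {0..1} (\<lambda>x. f x powr \<alpha>) (\<Psi> j k)\<bar>
        \<le> ?A * \<bar>K\<bar> * F * f x0 powr (\<alpha> - 1) * ((L / 2 ^ j) powr \<beta> * (L / 2 ^ j) * 2 powr (real j / 2))"
      unfolding F_def
      by (rule coefficient_bound_near_positive_value[OF assms S f a k uv(1-3,5) x0_uv x0(2) uv(4)])
    also have "\<dots> = C2 * (F / f x0 powr (1 - \<alpha>)) * 2 powr (- (real j / 2) * (2 * \<beta> + 1))"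
      using dyadic_scaling[OF L, of j \<beta>] x0(2) by (simp add: C2_def powr_diff mult_ac)
    also have "\<dots> \<le> (C1 + C2) * (F / f x0 powr (1 - \<alpha>)) * 2 powr (- (real j / 2) * (2 * \<beta> + 1))"
      using C F by (intro mult_right_mono) auto
    finally show ?thesis by (simp add: F_def)
  qed
  show ?thesis
  proof (intro exI[of _ "C1 + C2"] allI impI conjI ballI, goal_cases)
    case 1
    then show ?case by (intro uniform) auto
  next
    case 2
    then show ?case by (intro near) auto
  qed
qed

end
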